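(* Let $A$ be a finite alphabet, let $Z$ be a group code of $A^*$ and let $F$ be a uniformly recurrent connected set with alphabet $A$. Let $X=Z\cap F$. Then $d_F(X)=d(Z)$ and $G_F(X)\simeq G(Z)$.
   Context: All alphabets are finite. $A^*$ is the free monoid on $A$, $1$ is the empty word, $A^+=A^*\setminus\{1\}$. Group codes. A group code of $A^*$ is a subset $Z$ of $A^*$ that is a code (i.e., $Z\subseteq A^+$ freely generates the submonoid $Z^*$) such that $Z^*$ is recognized by a finite group automaton, that is, a finite trim automaton whose initial state is its unique final state and in which each letter of $A$ acts as a permutation on the set of states. (A group code is a rational maximal bifix code.) Recurrent and connected sets. $F\subseteq A^*$ is factorial if it contains every factor of each of its elements. A nonempty factorial set $F\neq\{1\}$ is recurrent if for all $u,v\in F$ there is $w\in F$ with $uwv\in F$; it is uniformly recurrent if moreover for every $u\in F$ there is a positive integer $n$ such that $u$ is a factor of every element of $F$ of length at least $n$. The alphabet of $F$ is the set of letters belonging to $F$. For $w\in F$ let $L(w)=\{a\in A\mid aw\in F\}$, $R(w)=\{a\in A\mid wa\in F\}$, $E(w)=\{(a,b)\in A\times A\mid awb\in F\}$; the extension graph of $w$ is the bipartite undirected graph whose vertex set is the disjoint union of copies of $L(w)$ and $R(w)$, with edge set $E(w)$, the edge $(a,b)$ joining $a\in L(w)$ to $b\in R(w)$. A recurrent set $F$ is connected if the extension graph of every $w\in F$ (including $w=1$) is connected. Degree. A parse of a word $w$ with respect to $X\subseteq A^*$ is a triple $(v,x,u)$ with $w=vxu$, $v\in A^*\setminus A^*X$,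 $x\in X^*$, $u\in A^*\setminus XA^*$; $\delta_X(w)$ is the number of parses of $w$. The $F$-degree is $d_F(X)=\sup\{\delta_X(w)\mid w\in F\}$, and the degree is $d(X)=d_{A^*}(X)$. Free profinite monoid and groups. $\widehat{A^*}$ is the free profinite monoid generated by $A$; $\overline{Y}$ is the topological closure of $Y$ in $\widehat{A^*}$. If $F$ is recurrent, there is a unique regular $\mathcal J$-class $J(F)$ of $\widehat{A^*}$ contained in $\overline F$ such that $\overline F$ is the set of factors in $\widehat{A^*}$ of elements of $J(F)$. The Schützenberger group of a regular $\mathcal J$-class (of a profinite, e.g. finite, monoid) is the isomorphism class of its maximal subgroups. For a rational language $L$, $M(L)$ is its syntactic monoid and $\hat\eta_L\colon\widehat{A^*}\to M(L)$ is the unique continuous extension of the syntactic homomorphism. For a rational code $Z$, $G(Z)$ is the Schützenberger group of the minimum ideal of $M(Z^* )$. For a rational code $X$ and a recurrent set $F$, $G_F(X)$ is the Schützenberger group of the regular $\mathcal J$-class $J_F(X)$ of $M(X^* )$ containing $\hat\eta_{X^*}(J(F))$. (Here $X=Z\cap F$ is known to be a finite bifix code.) *)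

theory Defs
  imports
    "HOL-Algebra.Group"
    "HOL-Analysis.Function_Topology"
    "HOL-Library.Sublist"
    "HOL-Library.Extended_Nat"
begin

text \<open>The alphabet \<open>A\<close> is a finite type \<open>'a\<close>, so that \<open>A\<^sup>*\<close> is the type \<open>'a list\<close>.\<close>


section \<open>Codes and group codes\<close>

definition star :: "'a list set \<Rightarrow> 'a list set" where
  "star X = concat ` lists X"

definition code :: "'a list set \<Rightarrow> bool" where
  "code X \<longleftrightarrow> [] \<notin> X \<and> inj_on concat (lists X)"

definition run :: "('a \<Rightarrow> 'q \<Rightarrow> 'q) \<Rightarrow> 'q \<Rightarrow> 'a list \<Rightarrow> 'q" where
  "run \<delta> q w = foldl (\<lambda>p a. \<delta> a p) q w"

text \<open>In a group automaton \<open>(Q, i, \<delta>)\<close> the state \<open>i\<close> is both the initial state and the only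
  final state; the last two conjuncts below say that the automaton is trim.\<close>

definition group_automaton :: "'q set \<Rightarrow> 'q \<Rightarrow> ('a \<Rightarrow> 'q \<Rightarrow> 'q) \<Rightarrow> bool" where
  "group_automaton Q i \<delta> \<longleftrightarrow>
     finite Q \<and> i \<in> Q \<and> (\<forall>a. bij_betw (\<delta> a) Q Q) \<and>
     (\<forall>q\<in>Q. \<exists>w. run \<delta> i w = q) \<and> (\<forall>q\<in>Q. \<exists>w. run \<delta> q w = i)"

definition recognized :: "'q \<Rightarrow> ('a \<Rightarrow> 'q \<Rightarrow> 'q) \<Rightarrow> 'a list set" where
  "recognized i \<delta> = {w. run \<delta> i w = i}"

text \<open>Up to renaming, the states of a finite automaton are natural numbers.\<close>

definition group_code :: "'a list set \<Rightarrow> bool" where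
  "group_code Z \<longleftrightarrow> code Z \<and>
     (\<exists>(Q :: nat set) i \<delta>. group_automaton Q i \<delta> \<and> star Z = recognized i \<delta>)"


section \<open>Recurrent and connected sets\<close>

definition factorial_set :: "'a list set \<Rightarrow> bool" where
  "factorial_set F \<longleftrightarrow> (\<forall>w\<in>F. \<forall>u. sublist u w \<longrightarrow> u \<in> F)"

definition recurrent :: "'a list set \<Rightarrow> bool" where
  "recurrent F \<longleftrightarrow> F \<noteq> {} \<and> F \<noteq> {[]} \<and> factorial_set F \<and>
     (\<forall>u\<in>F. \<forall>v\<in>F. \<exists>w\<in>F. u @ w @ v \<in> F)"

definition uniformly_recurrent :: "'a list set \<Rightarrow> bool" where
  "uniformly_recurrent F \<longleftrightarrow> recurrent F \<and>
     (\<forall>u\<in>F. \<exists>n>0. \<forall>w\<in>F. length w \<ge> n \<longrightarrow> sublist u w)"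

definition alphabet :: "'a list set \<Rightarrow> 'a set" where
  "alphabet F = {a. [a] \<in> F}"

definition left_ext :: "'a list set \<Rightarrow> 'a list \<Rightarrow> 'a set" where
  "left_ext F w = {a. a # w \<in> F}"

definition right_ext :: "'a list set \<Rightarrow> 'a list \<Rightarrow> 'a set" where
  "right_ext F w = {a. w @ [a] \<in> F}"

definition both_ext :: "'a list set \<Rightarrow> 'a list \<Rightarrow> ('a \<times> 'a) set" where
  "both_ext F w = {(a, b). a # w @ [b] \<in> F}"

definition ext_graph_verts :: "'a list set \<Rightarrow> 'a list \<Rightarrow> ('a + 'a) set" where
  "ext_graph_verts F w = Inl ` left_ext F w \<union> Inr ` right_ext F w"

definition ext_graph_edges :: "'a list set \<Rightarrow> 'a list \<Rightarrow> ('a + 'a) rel" where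
  "ext_graph_edges F w = {(Inl a, Inr b) | a b. (a, b) \<in> both_ext F w}"

definition connected_graph :: "'v set \<Rightarrow> 'v rel \<Rightarrow> bool" where
  "connected_graph V E \<longleftrightarrow> (\<forall>x\<in>V. \<forall>y\<in>V. (x, y) \<in> (E \<union> E\<inverse>)\<^sup>*)"

definition connected_set :: "'a list set \<Rightarrow> bool" where
  "connected_set F \<longleftrightarrow> recurrent F \<and>
     (\<forall>w\<in>F. connected_graph (ext_graph_verts F w) (ext_graph_edges F w))"


section \<open>Parses and degree\<close>

definition parses :: "'a list set \<Rightarrow> 'a list \<Rightarrow> ('a list \<times> 'a list \<times> 'a list) set" where
  "parses X w = {(v, x, u). w = v @ x @ u \<and>
     \<not> (\<exists>s\<in>X. suffix s v) \<and> x \<in> star X \<and> \<not> (\<exists>p\<in>X. prefix p u)}"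

definition F_degree :: "'a list set \<Rightarrow> 'a list set \<Rightarrow> enat" where
  "F_degree F X = (SUP w\<in>F. enat (card (parses X w)))"

definition code_degree :: "'a list set \<Rightarrow> enat" where
  "code_degree X = F_degree UNIV X"


section \<open>Green's relation J and Schutzenberger groups\<close>

definition factors_of :: "'m monoid \<Rightarrow> 'm set \<Rightarrow> 'm set" where
  "factors_of M S = {x \<in> carrier M.
     \<exists>u\<in>carrier M. \<exists>v\<in>carrier M. u \<otimes>\<^bsub>M\<^esub> x \<otimes>\<^bsub>M\<^esub> v \<in> S}"

definition J_class_of :: "'m monoid \<Rightarrow> 'm \<Rightarrow> 'm set" where
  "J_class_of M x = {y \<in> carrier M. x \<in> factors_of M {y} \<and> y \<in> factors_of M {x}}"

definition regular_J_class :: "'m monoid \<Rightarrow> 'm set \<Rightarrow> bool" where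
  "regular_J_class M J \<longleftrightarrow>
     (\<exists>x\<in>carrier M. J = J_class_of M x) \<and> (\<exists>e\<in>J. e \<otimes>\<^bsub>M\<^esub> e = e)"

text \<open>A subgroup of a monoid is a subset that is a group under the multiplication of the monoid;
  its identity need not be that of the monoid.\<close>

definition monoid_subgroup :: "'m monoid \<Rightarrow> 'm monoid \<Rightarrow> bool" where
  "monoid_subgroup M G \<longleftrightarrow> group G \<and>
     (\<exists>H e. H \<subseteq> carrier M \<and> G = M\<lparr>carrier := H, one := e\<rparr>)"

definition maximal_subgroup :: "'m monoid \<Rightarrow> 'm monoid \<Rightarrow> bool" where
  "maximal_subgroup M G \<longleftrightarrow> monoid_subgroup M G \<and>
     (\<forall>K. monoid_subgroup M K \<and> carrier G \<subseteq> carrier K \<longrightarrow> carrier K = carrier G)"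

text \<open>The maximal subgroups contained in a regular J-class are pairwise isomorphic, so that the
  isomorphism class is given by any representative.\<close>

definition schutzenberger_group :: "'m monoid \<Rightarrow> 'm set \<Rightarrow> 'm monoid" where
  "schutzenberger_group M J = (SOME G. maximal_subgroup M G \<and> carrier G \<subseteq> J)"

definition monoid_ideal :: "'m monoid \<Rightarrow> 'm set \<Rightarrow> bool" where
  "monoid_ideal M I \<longleftrightarrow> I \<noteq> {} \<and> I \<subseteq> carrier M \<and>
     (\<forall>x\<in>I. \<forall>m\<in>carrier M. m \<otimes>\<^bsub>M\<^esub> x \<in> I \<and> x \<otimes>\<^bsub>M\<^esub> m \<in> I)"

definition minimum_ideal :: "'m monoid \<Rightarrow> 'm set" where
  "minimum_ideal M = (LEAST I. monoid_ideal M I)"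


section \<open>Quotients of the free monoid\<close>

definition list_congruence :: "'a list rel \<Rightarrow> bool" where
  "list_congruence \<theta> \<longleftrightarrow> equiv UNIV \<theta> \<and>
     (\<forall>u u' v v'. (u, u') \<in> \<theta> \<longrightarrow> (v, v') \<in> \<theta> \<longrightarrow> (u @ v, u' @ v') \<in> \<theta>)"

definition quotient_monoid :: "'a list rel \<Rightarrow> 'a list set monoid" where
  "quotient_monoid \<theta> =
     \<lparr>carrier = UNIV // \<theta>,
      monoid.mult = (\<lambda>C D. \<Union>u\<in>C. \<Union>v\<in>D. \<theta> `` {u @ v}),
      one = \<theta> `` {[]}\<rparr>"

definition syntactic_congruence :: "'a list set \<Rightarrow> 'a list rel" where
  "syntactic_congruence L = {(u, v). \<forall>x y. x @ u @ y \<in> L \<longleftrightarrow> x @ v @ y \<in> L}"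

definition syntactic_monoid :: "'a list set \<Rightarrow> 'a list set monoid" where
  "syntactic_monoid L = quotient_monoid (syntactic_congruence L)"

definition syntactic_hom :: "'a list set \<Rightarrow> 'a list \<Rightarrow> 'a list set" where
  "syntactic_hom L w = syntactic_congruence L `` {w}"


section \<open>The free profinite monoid\<close>

text \<open>The free profinite monoid is the inverse limit of the finite quotients of \<open>A\<^sup>*\<close>: its
  elements are the compatible families of classes, indexed by the congruences of finite index
  (for \<open>\<theta> \<subseteq> \<theta>'\<close>, the canonical map sends a \<open>\<theta>\<close>-class to the \<open>\<theta>'\<close>-class containing it).\<close>

definition finite_congruences :: "'a list rel set" where
  "finite_congruences = {\<theta>. list_congruence \<theta> \<and> finite (UNIV // \<theta>)}"

type_synonym 'a profinite = "'a list rel \<Rightarrow> 'a list set"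

definition profinite_monoid :: "'a profinite monoid" where
  "profinite_monoid =
     \<lparr>carrier = {x \<in> (\<Pi>\<^sub>E \<theta>\<in>finite_congruences. carrier (quotient_monoid \<theta>)).
        \<forall>\<theta>\<in>finite_congruences. \<forall>\<theta>'\<in>finite_congruences. \<theta> \<subseteq> \<theta>' \<longrightarrow> x \<theta> \<subseteq> x \<theta>'},
      monoid.mult = (\<lambda>x y. \<lambda>\<theta>\<in>finite_congruences. x \<theta> \<otimes>\<^bsub>quotient_monoid \<theta>\<^esub> y \<theta>),
      one = (\<lambda>\<theta>\<in>finite_congruences. \<one>\<^bsub>quotient_monoid \<theta>\<^esub>)\<rparr>"

definition profinite_topology :: "'a profinite topology" where
  "profinite_topology =
     subtopology
       (product_topology (\<lambda>\<theta>. discrete_topology (carrier (quotient_monoid \<theta>))) finite_congruences)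
       (carrier profinite_monoid)"

text \<open>The canonical embedding of \<open>A\<^sup>*\<close>.\<close>

definition of_word :: "'a list \<Rightarrow> 'a profinite" where
  "of_word w = (\<lambda>\<theta>\<in>finite_congruences. \<theta> `` {w})"

definition profinite_closure :: "'a list set \<Rightarrow> 'a profinite set" where
  "profinite_closure Y = profinite_topology closure_of (of_word ` Y)"

text \<open>The continuous extension of the syntactic homomorphism, for rational \<open>L\<close>; membership in
  \<open>extensional\<close> only fixes the values outside the free profinite monoid.\<close>

definition syntactic_hom_ext :: "'a list set \<Rightarrow> 'a profinite \<Rightarrow> 'a list set" where
  "syntactic_hom_ext L =
     (THE f. f \<in> extensional (carrier profinite_monoid) \<and>
        continuous_map profinite_topology (discrete_topology (carrier (syntactic_monoid L))) f \<and>
        (\<forall>w. f (of_word w) = syntactic_hom L w))"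


section \<open>The groups of a code\<close>

text \<open>\<open>J_of F\<close> is the J-class \<open>J(F)\<close>, for recurrent \<open>F\<close>.\<close>

definition J_of :: "'a list set \<Rightarrow> 'a profinite set" where
  "J_of F = (THE J. regular_J_class profinite_monoid J \<and> J \<subseteq> profinite_closure F \<and>
     profinite_closure F = factors_of profinite_monoid J)"

definition J_of_code :: "'a list set \<Rightarrow> 'a list set \<Rightarrow> 'a list set set" where
  "J_of_code F X = (THE J. regular_J_class (syntactic_monoid (star X)) J \<and>
     syntactic_hom_ext (star X) ` J_of F \<subseteq> J)"

definition group_of_code :: "'a list set \<Rightarrow> 'a list set monoid" where
  "group_of_code Z =
     schutzenberger_group (syntactic_monoid (star Z)) (minimum_ideal (syntactic_monoid (star Z)))"

definition F_group_of_code :: "'a list set \<Rightarrow> 'a list set \<Rightarrow> 'a list set monoid" where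
  "F_group_of_code F X =
     schutzenberger_group (syntactic_monoid (star X)) (J_of_code F X)"

end

theory Submission
  imports Defs "HOL-Library.Ramsey" "HOL-Algebra.Coset"
begin

text \<open>Let \<open>Q\<close> be the state set of the group automaton of \<open>Z\<close> and \<open>G\<close> its transition group. The key
  fact is a rigidity of connected sets: if the words of length \<open>m\<close> of \<open>F\<close> are labelled by elements of
  a set on which the letters act injectively, compatibly with the passage from \<open>c y\<close> to \<open>y b\<close> for
  \<open>c y b\<close> in \<open>F\<close>, then the labelling is constant and its value is fixed by all letters.

  Labelling a long word by the set of states reached from the initial state by its suffixes, one
  finds a word of \<open>F\<close> for which this set is \<open>Q\<close>. As these states correspond to the parses, both
  degrees are \<open>card Q\<close>; moreover \<open>X\<close> is finite and every word of \<open>F\<close> can be completed to a word of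
  \<open>star X\<close>.

  The J-class \<open>J(F)\<close> contains an idempotent that is a limit of arbitrarily long words of \<open>F\<close>, so its
  image in the syntactic monoid of \<open>star X\<close> is the class of a long word \<open>w0\<close> of \<open>F\<close>. On the image of
  \<open>w0\<close>, residuals of \<open>star X\<close> are determined by the corresponding states in \<open>Q\<close>, which embeds the maximal
  subgroup at \<open>w0\<close> into \<open>G\<close>. Its image contains the values of the return words to \<open>w0\<close>; labelling long
  words \<open>u w0 v\<close> by the coset of \<open>v\<close>, rigidity shows that the image is all of \<open>G\<close>.\<close>

section \<open>Words and recurrent sets\<close>

text \<open>Words that occur in no word of \<open>star X\<close> are all congruent modulo its
  syntactic congruence, which therefore need not refine that of \<open>star Z\<close>: in general
  there is no homomorphism between the two syntactic monoids that could compare the groups. The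
  comparison is local. After a word \<open>w0\<close> of \<open>F\<close> at least as long as all
  words of \<open>X\<close>, a nonempty residual of \<open>star X\<close> carries exactly the
  information of a state in \<open>Q\<close>. Hence \<open>w0\<close> has to be long, idempotent and
  in \<open>F\<close>, and the free profinite monoid is only the source of such a word. In the
  rigidity statement, injectivity lets a label of \<open>y @ [b]\<close> be pulled back along
  \<open>b\<close>, so that it can be compared with the labels of the words \<open>c # y\<close>.
  Uniform recurrence provides one length from which all words of \<open>F\<close> contain a given
  word; a label read off at an occurrence of that word is then defined on a whole Rauzy
  graph.\<close>

lemma factorial_setD: "factorial_set F \<Longrightarrow> u @ v @ w \<in> F \<Longrightarrow> v \<in> F"
  unfolding factorial_set_def by (metis sublist_appendI)

lemma factorial_set_prefixD: "factorial_set F \<Longrightarrow> u @ v \<in> F \<Longrightarrow> u \<in> F"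
  using factorial_setD[of F "[]" u v] by simp

lemma factorial_set_suffixD: "factorial_set F \<Longrightarrow> u @ v \<in> F \<Longrightarrow> v \<in> F"
  using factorial_setD[of F u v "[]"] by simp

lemma recurrent_nonempty_word:
  assumes "recurrent F"
  obtains u where "u \<in> F" "u \<noteq> []"
  using assms unfolding recurrent_def by blast

lemma recurrent_left_ext:
  assumes F: "recurrent F" and "y \<in> F"
  obtains c where "c # y \<in> F"
proof -
  obtain u where u: "u \<in> F" "u \<noteq> []" by (rule recurrent_nonempty_word[OF F])
  obtain w where w: "u @ w @ y \<in> F" using F u(1) \<open>y \<in> F\<close> unfolding recurrent_def by blast
  have "u @ w \<noteq> []" using u(2) by simp
  then obtain p c where "u @ w = p @ [c]" by (metis append_butlast_last_id)
  then have "u @ w @ y = p @ (c # y)" by (metis append.assoc append_Cons append_Nil)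
  then show ?thesis using that factorial_set_suffixD w F unfolding recurrent_def by metis
qed

lemma recurrent_Nil: "recurrent F \<Longrightarrow> [] \<in> F"
  by (metis append_Nil factorial_set_prefixD recurrent_def ex_in_conv)

lemma recurrent_long_word:
  assumes F: "recurrent F"
  shows "\<exists>w\<in>F. length w = n"
proof (induction n)
  case 0
  then show ?case using recurrent_Nil[OF F] by auto
next
  case (Suc n)
  then obtain w where w: "w \<in> F" "length w = n" by blast
  obtain c where "c # w \<in> F" by (rule recurrent_left_ext[OF F w(1)])
  with w(2) show ?case by force
qed

text \<open>A labelling of the Rauzy graph of order \<open>m\<close> that is compatible with an action of the
  letters descends to the Rauzy graph of order \<open>m - 1\<close>, because the extension graphs are
  connected; at order \<open>0\<close> its only value is fixed by every letter.\<close>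

proposition Rauzy_labelling_constant:
  assumes F: "connected_set F" and inj: "\<And>b. inj_on (act b) S"
    and "\<And>x. x \<in> F \<Longrightarrow> length x = m \<Longrightarrow> l x \<in> S"
    and "\<And>x b. x @ [b] \<in> F \<Longrightarrow> length x = m \<Longrightarrow> l (tl (x @ [b])) = act b (l x)"
  shows "\<exists>s\<in>S. (\<forall>x\<in>F. length x = m \<longrightarrow> l x = s) \<and> (\<forall>b. [b] \<in> F \<longrightarrow> act b s = s)"
  using assms(3,4)
proof (induction m arbitrary: l)
  case 0
  have "[] \<in> F" using F recurrent_Nil unfolding connected_set_def by blast
  with 0(1)[of "[]"] 0(2)[of "[]"] show ?case by force
next
  case (Suc m)
  have rec: "recurrent F" using F unfolding connected_set_def by blast
  have fac: "factorial_set F" using rec unfolding recurrent_def by blast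
  have wd: "l (c # y) = l (c' # y)"
    if y: "length y = m" "c # y \<in> F" "c' # y \<in> F" for c c' y
  proof -
    \<comment> \<open>\<open>g\<close> puts labels on both sides of the extension graph of
      \<open>y\<close>: on the right, the label before \<open>b\<close> is recovered by injectivity.
      The two ends of an edge get the same value, so \<open>g\<close> is constant by
      connectedness.\<close>
    define g where "g = case_sum (\<lambda>c. l (c # y)) (\<lambda>b. inv_into S (act b) (l (y @ [b])))"
    have edge: "g v = g v'" if vv: "(v, v') \<in> ext_graph_edges F y" for v v'
    proof -
      obtain a b where ab: "v = Inl a" "v' = Inr b" "a # y @ [b] \<in> F"
        using vv unfolding ext_graph_edges_def both_ext_def by blast
      have "a # y \<in> F" using factorial_set_prefixD[OF fac, of "a # y" "[b]"] ab(3) by simp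
      then have "l (a # y) \<in> S" using Suc.prems(1) y(1) by simp
      moreover have "l (y @ [b]) = act b (l (a # y))"
        using Suc.prems(2)[of "a # y" b] ab(3) y(1) by simp
      ultimately show ?thesis unfolding g_def ab by (simp add: inj)
    qed
    have "y \<in> F" using factorial_set_suffixD[OF fac, of "[c]" y] y(2) by simp
    then have "connected_graph (ext_graph_verts F y) (ext_graph_edges F y)"
      using F unfolding connected_set_def by blast
    moreover have "Inl c \<in> ext_graph_verts F y" "Inl c' \<in> ext_graph_verts F y"
      using y unfolding ext_graph_verts_def left_ext_def by auto
    ultimately have "(Inl c, Inl c') \<in> (ext_graph_edges F y \<union> (ext_graph_edges F y)\<inverse>)\<^sup>*"
      unfolding connected_graph_def by blast
    then have "g (Inl c) = g (Inl c')"
      by (induction rule: rtrancl_induct) (use edge in fastforce)+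
    then show ?thesis unfolding g_def by simp
  qed
  \<comment> \<open>By \<open>wd\<close> the choice of the left extension is immaterial; one exists
    because \<open>F\<close> is recurrent.\<close>
  define k where "k y = l ((SOME c. c # y \<in> F) # y)" for y
  have k: "l (c # y) = k y" if "length y = m" "c # y \<in> F" for c y
    unfolding k_def by (rule wd[OF that]) (rule someI[of _ c], rule that(2))
  have "\<exists>s\<in>S. (\<forall>x\<in>F. length x = m \<longrightarrow> k x = s) \<and> (\<forall>b. [b] \<in> F \<longrightarrow> act b s = s)"
  proof (rule Suc.IH)
    fix x assume x: "x \<in> F" "length x = m"
    obtain c where "c # x \<in> F" by (rule recurrent_left_ext[OF rec x(1)])
    then show "k x \<in> S" using k[OF x(2)] Suc.prems(1)[of "c # x"] x(2) by simp
  next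
    fix x b assume x: "x @ [b] \<in> F" "length x = m"
    obtain d where d: "d # x @ [b] \<in> F" by (rule recurrent_left_ext[OF rec x(1)])
    have "d # x \<in> F" using factorial_set_prefixD[OF fac, of "d # x" "[b]"] d by simp
    then have "act b (k x) = l (x @ [b])"
      using k[OF x(2)] Suc.prems(2)[of "d # x" b] d x(2) by simp
    moreover obtain c where "x @ [b] = c # tl (x @ [b])" by (metis Nil_is_append_conv list.collapse not_Cons_self2)
    moreover have "length (tl (x @ [b])) = m" using x(2) by simp
    ultimately show "k (tl (x @ [b])) = act b (k x)" using k x(1) by metis
  qed
  then obtain s where s: "s \<in> S" "\<And>x. x \<in> F \<Longrightarrow> length x = m \<Longrightarrow> k x = s" "\<And>b. [b] \<in> F \<Longrightarrow> act b s = s"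
    by blast
  have "l x = s" if xF: "x \<in> F" and lx: "length x = Suc m" for x
  proof -
    obtain c y where x: "x = c # y" using lx by (cases x) auto
    have "y \<in> F" using factorial_set_suffixD[OF fac, of "[c]" y] xF x by simp
    then show ?thesis using k[of y c] s(2)[of y] xF lx x by simp
  qed
  with s show ?case by blast
qed


section \<open>Group automata\<close>

lemma run_Nil [simp]: "run \<delta> q [] = q"
  and run_append [simp]: "run \<delta> q (u @ v) = run \<delta> (run \<delta> q u) v"
  by (simp_all add: run_def)

locale perm_automaton =
  fixes Q :: "'q set" and i :: 'q and \<delta> :: "'a \<Rightarrow> 'q \<Rightarrow> 'q"
  assumes aut: "group_automaton Q i \<delta>"
begin

lemma fin_Q: "finite Q" and i_in [simp]: "i \<in> Q"
  using aut unfolding group_automaton_def by auto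

lemma bij_run: "bij_betw (\<lambda>q. run \<delta> q w) Q Q"
proof (induction w)
  case Nil
  then show ?case by (simp add: run_def bij_betw_def)
next
  case (Cons a w)
  have "bij_betw (\<delta> a) Q Q" using aut unfolding group_automaton_def by auto
  from bij_betw_trans[OF this Cons] show ?case by (simp add: run_def comp_def)
qed

lemma run_in [simp]: "q \<in> Q \<Longrightarrow> run \<delta> q w \<in> Q"
  using bij_run[of w] by (auto simp: bij_betw_def)

lemma run_eq_iff [simp]: "p \<in> Q \<Longrightarrow> q \<in> Q \<Longrightarrow> run \<delta> p w = run \<delta> q w \<longleftrightarrow> p = q"
  using bij_run[of w] by (auto simp: bij_betw_def inj_on_def)

lemma run_surj:
  assumes "q \<in> Q"
  obtains p where "p \<in> Q" "run \<delta> p w = q"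
proof -
  have "q \<in> (\<lambda>q. run \<delta> q w) ` Q" using assms bij_run[of w] by (simp add: bij_betw_def)
  then show ?thesis using that by auto
qed

lemma reach: "q \<in> Q \<Longrightarrow> \<exists>w. run \<delta> i w = q"
  using aut unfolding group_automaton_def by blast

text \<open>The states reached at the end of \<open>w\<close> when starting in \<open>i\<close> somewhere inside \<open>w\<close>; they
  correspond to the parses of \<open>w\<close>.\<close>

definition states :: "'a list \<Rightarrow> 'q set" where
  "states w = {run \<delta> i s | s. suffix s w}"

lemma states_subset: "states w \<subseteq> Q"
  unfolding states_def by auto

lemma finite_states: "finite (states w)"
  by (rule finite_subset[OF states_subset fin_Q])

lemma states_append_left: "states v \<subseteq> states (u @ v)"
  unfolding states_def by (auto intro: suffix_appendI)

lemma states_append_right: "(\<lambda>q. run \<delta> q v) ` states u \<subseteq> states (u @ v)"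
  unfolding states_def by (auto simp: suffix_def) (metis append.assoc run_append)

lemma card_image_states: "card ((\<lambda>q. run \<delta> q v) ` states u) = card (states u)"
proof (rule card_image)
  show "inj_on (\<lambda>q. run \<delta> q v) (states u)"
    using bij_run[of v] states_subset[of u] unfolding bij_betw_def by (blast intro: inj_on_subset)
qed

text \<open>Take \<open>w\<close> with as many states as possible. Extending a word to the left
  enlarges the set of states, extending it to the right does so up to a permutation; hence all words
  of \<open>F\<close> containing \<open>w\<close> have equally many states. The set of states is
  then a compatible labelling, and its constant value contains \<open>i\<close> and is stable under
  all letters.\<close>

lemma full_word:
  assumes F: "uniformly_recurrent F" "connected_set F" "alphabet F = UNIV"
  shows "\<exists>w\<in>F. states w = Q"
proof -
  have rec: "recurrent F" using F unfolding connected_set_def by blast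
  define N where "N = (\<lambda>w. card (states w)) ` F"
  have N: "finite N" "N \<noteq> {}"
    using recurrent_Nil[OF rec] card_mono[OF fin_Q states_subset]
    unfolding N_def by (auto intro!: finite_subset[of _ "{..card Q}"])
  then have "Max N \<in> N" by (rule Max_in)
  then obtain w where w: "w \<in> F" "card (states w) = Max N"
    unfolding N_def by (metis (no_types, lifting) imageE)
  have card_le: "card (states x) \<le> card (states w)" if "x \<in> F" for x
    unfolding w(2) using that N by (auto simp: N_def)
  have max: "card (states x) = card (states w)" if xF: "x \<in> F" and wx: "sublist w x" for x
  proof (rule antisym[OF card_le[OF xF]])
    obtain u v where x: "x = u @ w @ v" using wx by (auto simp: sublist_def)
    have "card (states w) \<le> card (states (u @ w))"
      by (rule card_mono[OF finite_states states_append_left])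
    also have "\<dots> = card ((\<lambda>q. run \<delta> q v) ` states (u @ w))" by (simp add: card_image_states)
    also have "\<dots> \<le> card (states x)"
      unfolding x using card_mono[OF finite_states states_append_right[of v "u @ w"]] by simp
    finally show "card (states w) \<le> card (states x)" .
  qed
  obtain n where n: "\<And>x. x \<in> F \<Longrightarrow> length x \<ge> n \<Longrightarrow> sublist w x"
    using F(1) w(1) unfolding uniformly_recurrent_def by blast
  have fac: "factorial_set F" using rec unfolding recurrent_def by blast
  have "\<exists>s\<in>Pow Q. (\<forall>x\<in>F. length x = n \<longrightarrow> states x = s) \<and>
      (\<forall>b. [b] \<in> F \<longrightarrow> (\<lambda>q. run \<delta> q [b]) ` s = s)"
  proof (rule Rauzy_labelling_constant[OF F(2)])
    show "inj_on ((`) (\<lambda>q. run \<delta> q [b])) (Pow Q)" for b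
      using bij_run[of "[b]"] by (intro inj_on_image_Pow) (auto simp: bij_betw_def)
    show "states x \<in> Pow Q" for x using states_subset by simp
    fix x b assume x: "x @ [b] \<in> F" "length x = n"
    have xF: "x \<in> F" by (rule factorial_set_prefixD[OF fac x(1)])
    obtain c y where cy: "x @ [b] = [c] @ y" "length y = n"
      using x(2) by (metis append_Cons append_Nil length_Suc_conv length_append_singleton)
    have yF: "y \<in> F" using factorial_set_suffixD[OF fac, of "[c]" y] cy x(1) by simp
    have card: "card (states (x @ [b])) = card (states w)" "card (states x) = card (states w)"
      "card (states y) = card (states w)"
      using max n x xF yF cy(2) by simp_all
    \<comment> \<open>Deleting the first letter and appending \<open>b\<close> both give inclusions
      into the states of \<open>x @ [b]\<close>; equal cardinalities turn them into
      equalities.\<close>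
    have "states y \<subseteq> states (x @ [b])" unfolding cy(1) by (rule states_append_left)
    then have "states y = states (x @ [b])" using card finite_states by (metis card_subset_eq)
    moreover have "(\<lambda>q. run \<delta> q [b]) ` states x = states (x @ [b])"
      using card_subset_eq[OF finite_states states_append_right[of "[b]" x]] card card_image_states by metis
    ultimately show "states (tl (x @ [b])) = (\<lambda>q. run \<delta> q [b]) ` states x"
      using cy(1) by simp
  qed
  then obtain s where s: "\<forall>x\<in>F. length x = n \<longrightarrow> states x = s"
    "\<forall>b. [b] \<in> F \<longrightarrow> (\<lambda>q. run \<delta> q [b]) ` s = s" by (elim bexE conjE) (rule that)
  obtain x where x: "x \<in> F" "length x = n" using recurrent_long_word[OF rec] by blast
  have fixed: "(\<lambda>q. run \<delta> q v) ` s = s" for v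
  proof (induction v rule: rev_induct)
    case Nil
    then show ?case by simp
  next
    case (snoc b v)
    have "(\<lambda>q. run \<delta> q (v @ [b])) ` s = (\<lambda>q. run \<delta> q [b]) ` (\<lambda>q. run \<delta> q v) ` s"
      by (simp add: image_image)
    also have "\<dots> = s" unfolding snoc using s(2) F(3) unfolding alphabet_def by auto
    finally show ?case .
  qed
  have xs: "states x = s" using s(1) x by simp
  have "run \<delta> i [] \<in> states x" unfolding states_def by (rule CollectI, rule exI[of _ "[]"], simp)
  then have "i \<in> s" using xs by simp
  then have "run \<delta> i w \<in> s" for w using fixed[of w] by blast
  then have "Q \<subseteq> s" using reach by (metis subsetI)
  then show ?thesis using xs states_subset[of x] x(1) by blast
qed

end


section \<open>Maximal subgroups of a monoid\<close>

text \<open>The group of units of the local monoid \<open>e M e\<close>, which is the largest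
  subgroup with identity \<open>e\<close>.\<close>

definition local_units :: "'m monoid \<Rightarrow> 'm \<Rightarrow> 'm set" where
  "local_units M e = {h \<in> carrier M. e \<otimes>\<^bsub>M\<^esub> h = h \<and> h \<otimes>\<^bsub>M\<^esub> e = h \<and>
     (\<exists>k\<in>carrier M. e \<otimes>\<^bsub>M\<^esub> k = k \<and> k \<otimes>\<^bsub>M\<^esub> e = k \<and> h \<otimes>\<^bsub>M\<^esub> k = e \<and> k \<otimes>\<^bsub>M\<^esub> h = e)}"

definition group_at :: "'m monoid \<Rightarrow> 'm \<Rightarrow> 'm monoid" where
  "group_at M e = M\<lparr>carrier := local_units M e, one := e\<rparr>"

lemma group_at_simps [simp]:
  "carrier (group_at M e) = local_units M e" "mult (group_at M e) = mult M" "one (group_at M e) = e"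
  by (simp_all add: group_at_def)

lemma factors_ofI:
  "\<lbrakk>x \<in> carrier M; u \<in> carrier M; v \<in> carrier M; u \<otimes>\<^bsub>M\<^esub> x \<otimes>\<^bsub>M\<^esub> v \<in> S\<rbrakk> \<Longrightarrow> x \<in> factors_of M S"
  unfolding factors_of_def by blast

lemma factors_ofE:
  assumes "x \<in> factors_of M S"
  obtains u v where "x \<in> carrier M" "u \<in> carrier M" "v \<in> carrier M" "u \<otimes>\<^bsub>M\<^esub> x \<otimes>\<^bsub>M\<^esub> v \<in> S"
  using assms unfolding factors_of_def by blast

lemma regular_J_classI:
  assumes "e \<in> carrier M" "e \<otimes>\<^bsub>M\<^esub> e = e" "e \<in> J_class_of M e"
  shows "regular_J_class M (J_class_of M e)"
  using assms unfolding regular_J_class_def by blast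

text \<open>The notions of \<open>Defs\<close> are typed for plain monoid records, whereas the locale \<open>monoid\<close> also
  covers record extensions.\<close>

locale plain_monoid = monoid G for G :: "'m monoid" (structure)
begin

lemma factors_of_refl: "x \<in> carrier G \<Longrightarrow> x \<in> S \<Longrightarrow> x \<in> factors_of G S"
  by (rule factors_ofI[of _ _ \<one> \<one>]) auto

lemma factors_of_trans:
  assumes "x \<in> factors_of G {y}" "y \<in> factors_of G S"
  shows "x \<in> factors_of G S"
proof -
  obtain u v where 1: "x \<in> carrier G" "u \<in> carrier G" "v \<in> carrier G" "u \<otimes> x \<otimes> v = y"
    using assms(1) by (auto elim: factors_ofE)
  obtain u' v' where 2: "u' \<in> carrier G" "v' \<in> carrier G" "u' \<otimes> y \<otimes> v' \<in> S"
    using assms(2) by (auto elim: factors_ofE)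
  have "(u' \<otimes> u) \<otimes> x \<otimes> (v \<otimes> v') = u' \<otimes> (u \<otimes> x \<otimes> v) \<otimes> v'" using 1(1,2,3) 2(1,2) by (simp add: m_assoc)
  then show ?thesis using 1 2 by (auto intro!: factors_ofI[of _ _ "u' \<otimes> u" "v \<otimes> v'"])
qed

lemma J_class_of_self: "x \<in> carrier G \<Longrightarrow> x \<in> J_class_of G x"
  unfolding J_class_of_def by (simp add: factors_of_refl)

lemma J_class_of_eq:
  assumes "x \<in> J_class_of G y"
  shows "J_class_of G x = J_class_of G y"
  using assms factors_of_trans unfolding J_class_of_def by blast

lemma factors_of_J_class:
  assumes "e \<in> carrier G"
  shows "factors_of G (J_class_of G e) = factors_of G {e}"
proof
  show "factors_of G {e} \<subseteq> factors_of G (J_class_of G e)"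
    using J_class_of_self[OF assms] unfolding factors_of_def by blast
  show "factors_of G (J_class_of G e) \<subseteq> factors_of G {e}"
  proof
    fix x assume "x \<in> factors_of G (J_class_of G e)"
    then obtain u v where uv: "x \<in> carrier G" "u \<in> carrier G" "v \<in> carrier G"
      "u \<otimes> x \<otimes> v \<in> J_class_of G e" by (rule factors_ofE)
    have "x \<in> factors_of G {u \<otimes> x \<otimes> v}" using uv by (intro factors_ofI[of _ _ u v]) auto
    moreover have "u \<otimes> x \<otimes> v \<in> factors_of G {e}" using uv(4) unfolding J_class_of_def by blast
    ultimately show "x \<in> factors_of G {e}" by (rule factors_of_trans)
  qed
qed

lemma local_units_one:
  "e \<in> carrier G \<Longrightarrow> e \<otimes> e = e \<Longrightarrow> e \<in> local_units G e"
  unfolding local_units_def by auto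

lemma group_group_at:
  assumes e: "e \<in> carrier G" "e \<otimes> e = e"
  shows "group (group_at G e)"
proof (rule groupI)
  fix x y assume "x \<in> carrier (group_at G e)" "y \<in> carrier (group_at G e)"
  then obtain x' y' where x: "x \<in> carrier G" "e \<otimes> x = x" "x \<otimes> e = x" "x' \<in> carrier G"
      "e \<otimes> x' = x'" "x' \<otimes> e = x'" "x \<otimes> x' = e" "x' \<otimes> x = e"
    and y: "y \<in> carrier G" "e \<otimes> y = y" "y \<otimes> e = y" "y' \<in> carrier G"
      "e \<otimes> y' = y'" "y' \<otimes> e = y'" "y \<otimes> y' = e" "y' \<otimes> y = e"
    unfolding group_at_simps local_units_def by blast
  have "(x \<otimes> y) \<otimes> (y' \<otimes> x') = x \<otimes> (y \<otimes> y') \<otimes> x'" using x(1,4) y(1,4) by (simp add: m_assoc)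
  then have 1: "(x \<otimes> y) \<otimes> (y' \<otimes> x') = e" using x y by simp
  have "(y' \<otimes> x') \<otimes> (x \<otimes> y) = y' \<otimes> (x' \<otimes> x) \<otimes> y" using x(1,4) y(1,4) by (simp add: m_assoc)
  then have 2: "(y' \<otimes> x') \<otimes> (x \<otimes> y) = e" using x y by simp
  have 3: "e \<otimes> (x \<otimes> y) = x \<otimes> y" "e \<otimes> (y' \<otimes> x') = y' \<otimes> x'"
    using x y e by (simp_all flip: m_assoc)
  have 4: "(x \<otimes> y) \<otimes> e = x \<otimes> y" "(y' \<otimes> x') \<otimes> e = y' \<otimes> x'"
    using x y e by (simp_all add: m_assoc)
  have "x \<otimes> y \<in> local_units G e"
    unfolding local_units_def using 1 2 3 4 x(1,4) y(1,4) by blast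
  then show "x \<otimes>\<^bsub>group_at G e\<^esub> y \<in> carrier (group_at G e)" by simp
next
  fix x assume "x \<in> carrier (group_at G e)"
  then obtain k where "x \<in> carrier G" "e \<otimes> x = x" "x \<otimes> e = x" "k \<in> carrier G"
    "e \<otimes> k = k" "k \<otimes> e = k" "x \<otimes> k = e" "k \<otimes> x = e"
    unfolding group_at_simps local_units_def by blast
  then have "k \<in> local_units G e" "k \<otimes> x = e" unfolding local_units_def by blast+
  then show "\<exists>y\<in>carrier (group_at G e). y \<otimes>\<^bsub>group_at G e\<^esub> x = \<one>\<^bsub>group_at G e\<^esub>" by auto
qed (use e local_units_one in \<open>auto simp: local_units_def m_assoc\<close>)

lemma monoid_subgroup_group_at:
  "e \<in> carrier G \<Longrightarrow> e \<otimes> e = e \<Longrightarrow> monoid_subgroup G (group_at G e)" 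
  unfolding monoid_subgroup_def using group_group_at[of e]
  by (auto simp: group_at_def intro!: exI[of _ "local_units G e"] exI[of _ e]) (simp add: local_units_def)

end

lemma monoid_subgroup_le_local_units:
  assumes "monoid_subgroup M K"
  shows "carrier K \<subseteq> local_units M (one K)" "one K \<in> carrier M"
    "one K \<otimes>\<^bsub>M\<^esub> one K = one K" "K = M\<lparr>carrier := carrier K, one := one K\<rparr>"
proof -
  obtain H e where He: "H \<subseteq> carrier M" "K = M\<lparr>carrier := H, one := e\<rparr>" and "group K"
    using assms unfolding monoid_subgroup_def by blast
  interpret K: group K by fact
  have m: "mult K = mult M" "carrier K \<subseteq> carrier M" using He by simp_all
  show "carrier K \<subseteq> local_units M (one K)"
  proof
    fix x assume x: "x \<in> carrier K"
    show "x \<in> local_units M (one K)" unfolding local_units_def m(1)[symmetric]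
      using x m(2) K.l_inv[OF x] K.r_inv[OF x] K.inv_closed[OF x] K.l_one K.r_one by blast
  qed
  show "one K \<in> carrier M" "one K \<otimes>\<^bsub>M\<^esub> one K = one K"
    using m(2) K.one_closed K.l_one[OF K.one_closed] unfolding m(1) by blast+
  show "K = M\<lparr>carrier := carrier K, one := one K\<rparr>" using He by simp
qed

text \<open>Any subgroup consists of local units at its own identity. Conversely, a subgroup
  containing the local units at \<open>e\<close> contains the idempotent \<open>e\<close>, which
  must be its identity.\<close>

lemma maximal_subgroup_iff:
  fixes M :: "'m monoid"
  assumes "plain_monoid M"
  shows "maximal_subgroup M K \<longleftrightarrow> (\<exists>e\<in>carrier M. e \<otimes>\<^bsub>M\<^esub> e = e \<and> K = group_at M e)"
proof
  interpret plain_monoid M by fact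
  assume K: "maximal_subgroup M K"
  then have "monoid_subgroup M K" unfolding maximal_subgroup_def by blast
  note * = monoid_subgroup_le_local_units[OF this]
  have "monoid_subgroup M (group_at M (one K))"
    by (rule monoid_subgroup_group_at[OF *(2,3)])
  moreover have "carrier K \<subseteq> carrier (group_at M (one K))" using *(1) by simp
  ultimately have "carrier (group_at M (one K)) = carrier K" using K unfolding maximal_subgroup_def by blast
  then have "K = group_at M (one K)" using *(4) unfolding group_at_def by simp
  with * show "\<exists>e\<in>carrier M. e \<otimes>\<^bsub>M\<^esub> e = e \<and> K = group_at M e" by blast
next
  interpret plain_monoid M by fact
  assume "\<exists>e\<in>carrier M. e \<otimes>\<^bsub>M\<^esub> e = e \<and> K = group_at M e"
  then obtain e where e: "e \<in> carrier M" "e \<otimes>\<^bsub>M\<^esub> e = e" "K = group_at M e" by blast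
  show "maximal_subgroup M K" unfolding maximal_subgroup_def
  proof (intro conjI allI impI)
    show "monoid_subgroup M K" unfolding e(3) by (rule monoid_subgroup_group_at[OF e(1,2)])
    fix K' assume "monoid_subgroup M K' \<and> carrier K \<subseteq> carrier K'"
    then have K': "monoid_subgroup M K'" "local_units M e \<subseteq> carrier K'" unfolding e(3) by simp_all
    note * = monoid_subgroup_le_local_units[OF K'(1)]
    have "e \<in> carrier K'" using K'(2) local_units_one[OF e(1,2)] by blast
    moreover have "group K'" using K'(1) unfolding monoid_subgroup_def by blast
    moreover have "mult K' = mult M" using arg_cong[OF *(4), of mult] by simp
    then have "e \<otimes>\<^bsub>K'\<^esub> e = e" using e(2) by simp
    ultimately have "e = one K'" by (metis group.l_cancel_one)
    with * K'(2) show "carrier K' = carrier K" unfolding e(3) by auto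
  qed
qed

lemma (in plain_monoid) local_units_subset_J_class:
  assumes e: "e \<in> carrier G" "e \<otimes> e = e"
  shows "local_units G e \<subseteq> J_class_of G e"
proof
  fix h assume "h \<in> local_units G e"
  then obtain k where h: "h \<in> carrier G" "e \<otimes> h = h" "k \<in> carrier G" "h \<otimes> k = e"
    unfolding local_units_def by blast
  then show "h \<in> J_class_of G e" unfolding J_class_of_def
    using e by (auto intro: factors_ofI[of _ _ e \<one>] factors_ofI[of _ _ \<one> k] factors_ofI[of _ _ \<one> h])
qed

text \<open>Left multiplication by \<open>y\<close> is undone by \<open>x\<close>, hence injective
  and, the carrier being finite, surjective; the right inverse of \<open>y\<close> so obtained
  equals \<open>x\<close>.\<close>

lemma (in plain_monoid) finite_inverse_comm:
  assumes "finite (carrier G)" and x: "x \<in> carrier G" "y \<in> carrier G" "x \<otimes> y = \<one>"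
  shows "y \<otimes> x = \<one>"
proof -
  have "inj_on (\<lambda>z. y \<otimes> z) (carrier G)"
  proof (rule inj_onI)
    fix a b assume ab: "a \<in> carrier G" "b \<in> carrier G" "y \<otimes> a = y \<otimes> b"
    then have "x \<otimes> (y \<otimes> a) = x \<otimes> (y \<otimes> b)" by simp
    then show "a = b" using ab(1,2) x by (simp flip: m_assoc)
  qed
  then have "(\<lambda>z. y \<otimes> z) ` carrier G = carrier G"
    using assms(1) x by (intro endo_inj_surj) auto
  then obtain z where z: "z \<in> carrier G" "y \<otimes> z = \<one>" by (metis imageE one_closed)
  have "x \<otimes> (y \<otimes> z) = z" using x z(1) by (simp flip: m_assoc)
  then have "z = x" using x z(2) by simp
  with z(2) show ?thesis by simp
qed

text \<open>Both \<open>f\<close> and \<open>e\<close> factor through each other, which gives \<open>x\<close>, \<open>y\<close> with \<open>x y = f\<close> and \<open>y x = e\<close>;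
  conjugation by these is the isomorphism.\<close>

lemma (in plain_monoid) J_equivalent_idempotents:
  assumes fin: "finite (carrier G)"
    and e: "e \<in> carrier G" "e \<otimes> e = e" and f: "f \<in> J_class_of G e" "f \<otimes> f = f"
  obtains x y where "x \<in> carrier G" "y \<in> carrier G" "x \<otimes> y = f" "y \<otimes> x = e"
    "f \<otimes> x = x" "x \<otimes> e = x" "e \<otimes> y = y" "y \<otimes> f = y"
proof -
  have fG: "f \<in> carrier G" using f(1) unfolding J_class_of_def by blast
  obtain a b where ab: "a \<in> carrier G" "b \<in> carrier G" "a \<otimes> e \<otimes> b = f"
    using f(1) unfolding J_class_of_def by (auto elim: factors_ofE)
  obtain c d where cd: "c \<in> carrier G" "d \<in> carrier G" "c \<otimes> f \<otimes> d = e"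
    using f(1) unfolding J_class_of_def by (auto elim: factors_ofE)
  define x y where "x = f \<otimes> a \<otimes> e" and "y = e \<otimes> b \<otimes> f"
  have xy: "x \<in> carrier G" "y \<in> carrier G" using ab e fG by (simp_all add: x_def y_def)
  have "x \<otimes> y = f \<otimes> (a \<otimes> (e \<otimes> e) \<otimes> b) \<otimes> f"
    using ab(1,2) e(1) fG by (simp add: x_def y_def m_assoc)
  then have xyf: "x \<otimes> y = f" using ab e f by simp
  have fx: "f \<otimes> x = x" and yf: "y \<otimes> f = y" and xe: "x \<otimes> e = x" and ey: "e \<otimes> y = y"
    using ab(1,2) e fG f(2) by (simp_all add: x_def y_def m_assoc flip: m_assoc[of f f] m_assoc[of e e])
  define g where "g = y \<otimes> x"
  have g: "g \<in> carrier G" "e \<otimes> g = g" "g \<otimes> e = g"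
    using xy e ey xe by (simp_all add: g_def m_assoc) (simp flip: m_assoc)
  have "g \<otimes> g = y \<otimes> (x \<otimes> y) \<otimes> x" using xy by (simp add: g_def m_assoc)
  then have gg: "g \<otimes> g = g" using xyf fx xy fG by (simp add: g_def m_assoc)
  have f_eq: "x \<otimes> g \<otimes> y = f" 
  proof -
    have "x \<otimes> g \<otimes> y = (x \<otimes> y) \<otimes> (x \<otimes> y)" using xy by (simp add: g_def m_assoc)
    then show ?thesis using xyf f(2) by simp
  qed
  \<comment> \<open>As \<open>f = x g y\<close>, the relation \<open>c f d = e\<close> gives
    \<open>p g q = e\<close> inside the finite local monoid \<open>e M e\<close>. There one-sided
    inverses are two-sided, so the idempotent \<open>g\<close> has a right inverse and equals
    \<open>e\<close>.\<close>
  define p q where "p = e \<otimes> c \<otimes> x \<otimes> e" and "q = e \<otimes> y \<otimes> d \<otimes> e"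
  let ?M = "G\<lparr>carrier := {h \<in> carrier G. e \<otimes> h = h \<and> h \<otimes> e = h}, one := e\<rparr>"
  interpret L: plain_monoid ?M
  proof (unfold plain_monoid_def, rule monoidI, goal_cases)
    case (1 u v)
    then show ?case using e by (auto simp: m_assoc) (simp flip: m_assoc)
  qed (use e in \<open>auto simp: m_assoc\<close>)
  have pq: "p \<in> carrier ?M" "q \<in> carrier ?M" "g \<in> carrier ?M"
    using xy cd(1,2) e g by (auto simp: p_def q_def m_assoc) (simp_all flip: m_assoc)
  have "p \<otimes> g \<otimes> q = e \<otimes> (c \<otimes> (x \<otimes> (e \<otimes> g \<otimes> e) \<otimes> y) \<otimes> d) \<otimes> e"
    using xy cd(1,2) e g(1) by (simp add: p_def q_def m_assoc)
  then have pgq: "p \<otimes> g \<otimes> q = e" using f_eq cd e g by (simp add: m_assoc)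
  have finM: "finite (carrier ?M)" using fin by simp
  have "p \<otimes>\<^bsub>?M\<^esub> (g \<otimes>\<^bsub>?M\<^esub> q) = \<one>\<^bsub>?M\<^esub>" "(p \<otimes>\<^bsub>?M\<^esub> g) \<otimes>\<^bsub>?M\<^esub> q = \<one>\<^bsub>?M\<^esub>" using pgq pq by (simp_all add: m_assoc)
  then have "g \<otimes>\<^bsub>?M\<^esub> q \<otimes>\<^bsub>?M\<^esub> p = \<one>\<^bsub>?M\<^esub>"
    using L.finite_inverse_comm[OF finM, of p "g \<otimes>\<^bsub>?M\<^esub> q"] pq L.m_closed[OF pq(3,2)] by simp
  then have gqp: "g \<otimes> (q \<otimes> p) = e" using pq by (simp add: m_assoc)
  have "g = g \<otimes> (g \<otimes> (q \<otimes> p))" using gqp g by simp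
  also have "\<dots> = g \<otimes> g \<otimes> (q \<otimes> p)" using pq by (subst m_assoc) auto
  also have "\<dots> = e" using gg gqp by simp
  finally have "g = e" .
  then show thesis using that xy xyf fx xe ey yf by (simp add: g_def)
qed

text \<open>The inverse map sends \<open>h\<close> to \<open>x h y\<close>. The facts
  \<open>closed\<close> and \<open>cancel\<close> are stated for a generic pair because each is used
  once in either direction.\<close>

lemma (in plain_monoid) group_at_iso:
  assumes xy: "x \<in> carrier G" "y \<in> carrier G" "x \<otimes> y = f" "y \<otimes> x = e"
    "f \<otimes> x = x" "x \<otimes> e = x" "e \<otimes> y = y" "y \<otimes> f = y"
  shows "(\<lambda>h. y \<otimes> h \<otimes> x) \<in> iso (group_at G f) (group_at G e)"
proof -
  have closed: "v \<otimes> h \<otimes> u \<in> local_units G c"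
    if uv: "u \<in> carrier G" "v \<in> carrier G" "v \<otimes> u = c" "u \<otimes> v = d" "c \<otimes> v = v" "u \<otimes> c = u" "v \<otimes> d = v" "d \<otimes> u = u"
      and h: "h \<in> local_units G d" for u v c d h
  proof -
    have mid: "(v \<otimes> a \<otimes> u) \<otimes> (v \<otimes> b \<otimes> u) = v \<otimes> (a \<otimes> b) \<otimes> u"
      if "a \<in> carrier G" "b \<in> carrier G" "a \<otimes> d = a" for a b
    proof -
      have "(v \<otimes> a \<otimes> u) \<otimes> (v \<otimes> b \<otimes> u) = v \<otimes> (a \<otimes> (u \<otimes> v) \<otimes> b) \<otimes> u" using uv(1,2) that(1,2) by (simp add: m_assoc)
      then show ?thesis using uv that by simp
    qed
    obtain k where k: "h \<in> carrier G" "d \<otimes> h = h" "h \<otimes> d = h" "k \<in> carrier G"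
      "d \<otimes> k = k" "k \<otimes> d = k" "h \<otimes> k = d" "k \<otimes> h = d" using h unfolding local_units_def by blast
    have vdu: "v \<otimes> d \<otimes> u = c" using uv by simp
    have lr: "c \<otimes> (v \<otimes> a \<otimes> u) = v \<otimes> a \<otimes> u" "(v \<otimes> a \<otimes> u) \<otimes> c = v \<otimes> a \<otimes> u" if "a \<in> carrier G" for a
    proof -
      have cG: "c \<in> carrier G" using uv(1-3) by auto
      have "c \<otimes> (v \<otimes> a \<otimes> u) = (c \<otimes> v) \<otimes> a \<otimes> u" using cG uv(1,2) that by (simp add: m_assoc)
      then show "c \<otimes> (v \<otimes> a \<otimes> u) = v \<otimes> a \<otimes> u" using uv by simp
      have "(v \<otimes> a \<otimes> u) \<otimes> c = v \<otimes> a \<otimes> (u \<otimes> c)" using cG uv(1,2) that by (simp add: m_assoc)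
      then show "(v \<otimes> a \<otimes> u) \<otimes> c = v \<otimes> a \<otimes> u" using uv by simp
    qed
    show ?thesis unfolding local_units_def
      using mid[OF k(1,4,3)] mid[OF k(4,1,6)] k vdu lr[OF k(1)] lr[OF k(4)] uv(1,2)
      by (auto intro!: bexI[of _ "v \<otimes> k \<otimes> u"])
  qed
  have fG: "f \<in> carrier G" "e \<in> carrier G" using xy(1-4) by auto
  have hom: "y \<otimes> (h \<otimes> h') \<otimes> x = (y \<otimes> h \<otimes> x) \<otimes> (y \<otimes> h' \<otimes> x)"
    if "h \<in> local_units G f" "h' \<in> local_units G f" for h h'
  proof -
    have h: "h \<in> carrier G" "h \<otimes> f = h" "h' \<in> carrier G" using that unfolding local_units_def by auto
    have "(y \<otimes> h \<otimes> x) \<otimes> (y \<otimes> h' \<otimes> x) = y \<otimes> (h \<otimes> (x \<otimes> y) \<otimes> h') \<otimes> x" using xy(1,2) h by (simp add: m_assoc)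
    then show ?thesis using xy h by simp
  qed
  have cancel: "v \<otimes> (u \<otimes> h \<otimes> v) \<otimes> u = h"
    if "u \<in> carrier G" "v \<in> carrier G" "v \<otimes> u = c" "h \<in> local_units G c" for u v c h
  proof -
    have h: "h \<in> carrier G" "c \<otimes> h = h" "h \<otimes> c = h" using that(4) unfolding local_units_def by auto
    have "v \<otimes> (u \<otimes> h \<otimes> v) \<otimes> u = (v \<otimes> u) \<otimes> h \<otimes> (v \<otimes> u)" using that(1,2) h(1) by (simp add: m_assoc)
    then show ?thesis using that(3) h by simp
  qed
  have "bij_betw (\<lambda>h. y \<otimes> h \<otimes> x) (local_units G f) (local_units G e)"
  proof (rule bij_betw_byWitness[where f' = "\<lambda>h. x \<otimes> h \<otimes> y"])
    show "\<forall>h\<in>local_units G f. x \<otimes> (y \<otimes> h \<otimes> x) \<otimes> y = h" using cancel[OF xy(2,1,3)] by blast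
    show "\<forall>h\<in>local_units G e. y \<otimes> (x \<otimes> h \<otimes> y) \<otimes> x = h" using cancel[OF xy(1,2,4)] by blast
    show "(\<lambda>h. y \<otimes> h \<otimes> x) ` local_units G f \<subseteq> local_units G e"
      using closed[OF xy(1,2,4,3,7,6,8,5)] by blast
    show "(\<lambda>h. x \<otimes> h \<otimes> y) ` local_units G e \<subseteq> local_units G f"
      using closed[OF xy(2,1,3,4,5,8,6,7)] by blast
  qed
  then show ?thesis using hom unfolding iso_def hom_def by (auto simp: bij_betw_def)
qed

text \<open>The subgroup at \<open>e\<close> shows that the choice behind
  \<open>schutzenberger_group\<close> is not void; whatever is chosen is the group at some
  idempotent of the class.\<close>

lemma schutzenberger_group_cases:
  fixes M :: "'m monoid"
  assumes "plain_monoid M" and e: "e \<in> carrier M" "e \<otimes>\<^bsub>M\<^esub> e = e"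
  obtains f where "f \<in> J_class_of M e" "f \<otimes>\<^bsub>M\<^esub> f = f"
    "schutzenberger_group M (J_class_of M e) = group_at M f"
proof -
  interpret plain_monoid M by fact
  let ?S = "schutzenberger_group M (J_class_of M e)"
  have "maximal_subgroup M (group_at M e) \<and> carrier (group_at M e) \<subseteq> J_class_of M e"
    using e local_units_subset_J_class[OF e] by (auto simp: maximal_subgroup_iff[OF \<open>plain_monoid M\<close>])
  then have S: "maximal_subgroup M ?S" "carrier ?S \<subseteq> J_class_of M e"
    unfolding schutzenberger_group_def
    by (metis (mono_tags, lifting) someI)+
  obtain f where f: "f \<in> carrier M" "f \<otimes>\<^bsub>M\<^esub> f = f" "?S = group_at M f"
    using S(1) unfolding maximal_subgroup_iff[OF \<open>plain_monoid M\<close>] by blast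
  have "f \<in> J_class_of M e" using S(2) local_units_one[OF f(1,2)] unfolding f(3) by auto
  with f show thesis using that by blast
qed

lemma group_schutzenberger_group:
  fixes M :: "'m monoid"
  assumes "plain_monoid M" and e: "e \<in> carrier M" "e \<otimes>\<^bsub>M\<^esub> e = e"
  shows "group (schutzenberger_group M (J_class_of M e))"
proof -
  interpret plain_monoid M by fact
  obtain f where "f \<in> J_class_of M e" "f \<otimes>\<^bsub>M\<^esub> f = f"
    "schutzenberger_group M (J_class_of M e) = group_at M f"
    by (rule schutzenberger_group_cases[OF assms])
  then show ?thesis using group_group_at unfolding J_class_of_def by simp
qed

lemma schutzenberger_group_iso:
  fixes M :: "'m monoid"
  assumes "plain_monoid M" and fin: "finite (carrier M)" and e: "e \<in> carrier M" "e \<otimes>\<^bsub>M\<^esub> e = e"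
  shows "schutzenberger_group M (J_class_of M e) \<cong> group_at M e"
proof -
  interpret plain_monoid M by fact
  obtain f where f: "f \<in> J_class_of M e" "f \<otimes>\<^bsub>M\<^esub> f = f"
    "schutzenberger_group M (J_class_of M e) = group_at M f"
    by (rule schutzenberger_group_cases[OF assms(1) e])
  obtain x y where "x \<in> carrier M" "y \<in> carrier M" "x \<otimes>\<^bsub>M\<^esub> y = f" "y \<otimes>\<^bsub>M\<^esub> x = e"
    "f \<otimes>\<^bsub>M\<^esub> x = x" "x \<otimes>\<^bsub>M\<^esub> e = x" "e \<otimes>\<^bsub>M\<^esub> y = y" "y \<otimes>\<^bsub>M\<^esub> f = y"
    by (rule J_equivalent_idempotents[OF fin e f(1,2)])
  from group_at_iso[OF this] show ?thesis unfolding f(3) is_iso_def by blast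
qed


section \<open>Quotients of the free monoid\<close>

lemma congruence_class_eq_iff:
  "list_congruence \<theta> \<Longrightarrow> \<theta> `` {u} = \<theta> `` {v} \<longleftrightarrow> (u, v) \<in> \<theta>"
  unfolding list_congruence_def using eq_equiv_class_iff[of UNIV \<theta>] by blast

lemma list_congruence_refl: "list_congruence \<theta> \<Longrightarrow> (u, u) \<in> \<theta>"
  unfolding list_congruence_def equiv_def by (blast dest: refl_onD)

lemma list_congruence_sym: "list_congruence \<theta> \<Longrightarrow> (u, v) \<in> \<theta> \<Longrightarrow> (v, u) \<in> \<theta>"
  unfolding list_congruence_def equiv_def by (blast dest: symD)

lemma list_congruence_trans:
  "list_congruence \<theta> \<Longrightarrow> (u, v) \<in> \<theta> \<Longrightarrow> (v, w) \<in> \<theta> \<Longrightarrow> (u, w) \<in> \<theta>"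
  unfolding list_congruence_def equiv_def by (blast dest: transD)

lemma list_congruence_append:
  "list_congruence \<theta> \<Longrightarrow> (u, u') \<in> \<theta> \<Longrightarrow> (v, v') \<in> \<theta> \<Longrightarrow> (u @ v, u' @ v') \<in> \<theta>"
  unfolding list_congruence_def by blast

lemma list_congruenceI:
  assumes "\<And>u. (u, u) \<in> \<theta>" "\<And>u v. (u, v) \<in> \<theta> \<Longrightarrow> (v, u) \<in> \<theta>"
    "\<And>u v w. (u, v) \<in> \<theta> \<Longrightarrow> (v, w) \<in> \<theta> \<Longrightarrow> (u, w) \<in> \<theta>"
    "\<And>u u' v v'. (u, u') \<in> \<theta> \<Longrightarrow> (v, v') \<in> \<theta> \<Longrightarrow> (u @ v, u' @ v') \<in> \<theta>"
  shows "list_congruence \<theta>"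
proof -
  have "refl \<theta>" "sym \<theta>" "trans \<theta>"
    by (rule refl_onI, rule assms(1)) (rule symI, rule assms(2), assumption, rule transI, rule assms(3))
  then have "equiv UNIV \<theta>" by (simp add: equiv_def)
  with assms(4) show ?thesis unfolding list_congruence_def by blast
qed

lemma carrier_quotient_monoid: "carrier (quotient_monoid \<theta>) = range (\<lambda>w. \<theta> `` {w})"
  unfolding quotient_monoid_def quotient_def by auto

lemma one_quotient_monoid: "\<one>\<^bsub>quotient_monoid \<theta>\<^esub> = \<theta> `` {[]}"
  unfolding quotient_monoid_def by simp

lemma mult_quotient_monoid:
  assumes "list_congruence \<theta>"
  shows "\<theta> `` {u} \<otimes>\<^bsub>quotient_monoid \<theta>\<^esub> \<theta> `` {v} = \<theta> `` {u @ v}"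
proof -
  have *: "\<theta> `` {u' @ v'} = \<theta> `` {u @ v}" if "u' \<in> \<theta> `` {u}" "v' \<in> \<theta> `` {v}" for u' v'
  proof -
    have "(u @ v, u' @ v') \<in> \<theta>" using that list_congruence_append[OF assms, of u u' v v'] by simp
    then show ?thesis using congruence_class_eq_iff[OF assms] by metis
  qed
  have ne: "\<theta> `` {u} \<noteq> {}" "\<theta> `` {v} \<noteq> {}" using list_congruence_refl[OF assms] by auto
  have "(\<Union>u'\<in>\<theta> `` {u}. \<Union>v'\<in>\<theta> `` {v}. \<theta> `` {u' @ v'}) = (\<Union>u'\<in>\<theta> `` {u}. \<Union>v'\<in>\<theta> `` {v}. \<theta> `` {u @ v})"
    by (intro SUP_cong refl) (rule *)
  also have "\<dots> = \<theta> `` {u @ v}" using ne by simp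
  finally show ?thesis unfolding quotient_monoid_def by simp
qed

lemma quotient_monoid_cases:
  assumes "C \<in> carrier (quotient_monoid \<theta>)"
  obtains w where "C = \<theta> `` {w}"
  using assms unfolding carrier_quotient_monoid by blast

lemma class_in_quotient_monoid [simp]: "\<theta> `` {w} \<in> carrier (quotient_monoid \<theta>)"
  unfolding carrier_quotient_monoid by blast

lemma plain_monoid_quotient_monoid:
  assumes "list_congruence \<theta>"
  shows "plain_monoid (quotient_monoid \<theta>)"
  unfolding plain_monoid_def
  by (rule monoidI)
    (auto simp: one_quotient_monoid mult_quotient_monoid[OF assms] elim!: quotient_monoid_cases)

lemma list_congruence_syntactic: "list_congruence (syntactic_congruence L)"
proof -
  have "(u @ v, u' @ v') \<in> syntactic_congruence L"
    if "(u, u') \<in> syntactic_congruence L" "(v, v') \<in> syntactic_congruence L" for u u' v v'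
  proof -
    have "x @ (u @ v) @ y \<in> L \<longleftrightarrow> x @ (u' @ v') @ y \<in> L" for x y
    proof -
      have "x @ u @ (v @ y) \<in> L \<longleftrightarrow> x @ u' @ (v @ y) \<in> L"
        using that(1) unfolding syntactic_congruence_def by blast
      moreover have "(x @ u') @ v @ y \<in> L \<longleftrightarrow> (x @ u') @ v' @ y \<in> L"
        using that(2) unfolding syntactic_congruence_def by blast
      ultimately show ?thesis by simp
    qed
    then show ?thesis unfolding syntactic_congruence_def by blast
  qed
  then show ?thesis
    by (intro list_congruenceI) (auto simp: syntactic_congruence_def)
qed

text \<open>The invariant \<open>f\<close> need not respect concatenation: a representative chosen
  for each of its finitely many values meets every class.\<close>

lemma finite_congruencesI:
  assumes "list_congruence \<theta>" "finite (range f)" "\<And>u v. f u = f v \<Longrightarrow> (u, v) \<in> \<theta>"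
  shows "\<theta> \<in> finite_congruences"
proof -
  have "\<theta> `` {w} = \<theta> `` {SOME v. f v = f w}" for w
    using assms(3)[of w "SOME v. f v = f w"] someI[of "\<lambda>v. f v = f w" w]
    by (simp add: congruence_class_eq_iff[OF assms(1)])
  then have "UNIV // \<theta> \<subseteq> (\<lambda>c. \<theta> `` {SOME v. f v = c}) ` range f"
    unfolding quotient_def by auto
  then have "finite (UNIV // \<theta>)" using assms(2) by (meson finite_imageI finite_subset)
  then show ?thesis using assms(1) unfolding finite_congruences_def by simp
qed

lemma finite_congruencesD:
  assumes "\<theta> \<in> finite_congruences"
  shows "list_congruence \<theta>" "finite (range (\<lambda>w. \<theta> `` {w}))"
  using assms carrier_quotient_monoid[of \<theta>] unfolding finite_congruences_def quotient_monoid_def by auto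

lemma finite_congruences_UNIV: "UNIV \<in> finite_congruences"
  by (rule finite_congruencesI[where f = "\<lambda>_. ()"]) (auto intro: list_congruenceI)

lemma finite_congruences_Int:
  assumes "\<theta> \<in> finite_congruences" "\<theta>' \<in> finite_congruences"
  shows "\<theta> \<inter> \<theta>' \<in> finite_congruences"
proof (rule finite_congruencesI)
  note c = finite_congruencesD[OF assms(1)] finite_congruencesD[OF assms(2)]
  show "list_congruence (\<theta> \<inter> \<theta>')"
    by (rule list_congruenceI; (elim IntE)?; intro IntI)
      (erule (1) list_congruence_refl[OF c(1)] list_congruence_refl[OF c(3)]
        list_congruence_sym[OF c(1)] list_congruence_sym[OF c(3)]
        list_congruence_trans[OF c(1)] list_congruence_trans[OF c(3)]
        list_congruence_append[OF c(1)] list_congruence_append[OF c(3)] |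
       rule list_congruence_refl[OF c(1)] list_congruence_refl[OF c(3)] |
       erule list_congruence_sym[OF c(1)] list_congruence_sym[OF c(3)])+
  have "range (\<lambda>w. (\<theta> `` {w}, \<theta>' `` {w})) \<subseteq> range (\<lambda>w. \<theta> `` {w}) \<times> range (\<lambda>w. \<theta>' `` {w})" by auto
  then show "finite (range (\<lambda>w. (\<theta> `` {w}, \<theta>' `` {w})))"
    by (rule finite_subset) (rule finite_cartesian_product[OF c(2,4)])
  show "(u, v) \<in> \<theta> \<inter> \<theta>'" if "(\<theta> `` {u}, \<theta>' `` {u}) = (\<theta> `` {v}, \<theta>' `` {v})" for u v
    using that congruence_class_eq_iff c(1,3) by auto
qed

lemma finite_congruences_INT:
  assumes "finite S" "S \<subseteq> finite_congruences"
  shows "\<Inter>S \<in> finite_congruences"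
  using assms by (induction S) (auto simp: finite_congruences_UNIV finite_congruences_Int)

text \<open>A product of two \<open>\<theta>\<close>-classes is a union of classes of \<open>refine \<theta>\<close>. Hence the profinite closure
  of a factorial set is factorial.\<close>

definition factorizations :: "'a list rel \<Rightarrow> 'a list \<Rightarrow> ('a list set \<times> 'a list set) set" where
  "factorizations \<theta> w = {(\<theta> `` {u}, \<theta> `` {v}) | u v. u @ v = w}"

definition refine :: "'a list rel \<Rightarrow> 'a list rel" where
  "refine \<theta> = {(u, v). factorizations \<theta> u = factorizations \<theta> v}"

lemma factorizations_class:
  assumes "list_congruence \<theta>" "(a, b) \<in> factorizations \<theta> w"
  shows "a \<otimes>\<^bsub>quotient_monoid \<theta>\<^esub> b = \<theta> `` {w}"
  using assms(2) mult_quotient_monoid[OF assms(1)] unfolding factorizations_def by auto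

text \<open>A cut of \<open>u @ v\<close> falls inside \<open>u\<close> or inside \<open>v\<close>.
  The factorizations of a product are thus determined by those of its factors and by their classes,
  which is why \<open>refine \<theta>\<close> is a congruence.\<close>

lemma factorizations_append:
  assumes "list_congruence \<theta>"
  shows "factorizations \<theta> (u @ v) =
    (\<lambda>(a, b). (a, b \<otimes>\<^bsub>quotient_monoid \<theta>\<^esub> \<theta> `` {v})) ` factorizations \<theta> u \<union>
    (\<lambda>(a, b). (\<theta> `` {u} \<otimes>\<^bsub>quotient_monoid \<theta>\<^esub> a, b)) ` factorizations \<theta> v" (is "?l = ?r1 \<union> ?r2")
proof
  show "?l \<subseteq> ?r1 \<union> ?r2"
  proof
    fix p assume "p \<in> ?l"
    then obtain x y where xy: "p = (\<theta> `` {x}, \<theta> `` {y})" "x @ y = u @ v"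
      unfolding factorizations_def by blast
    from xy(2) obtain t where "x @ t = u \<and> y = t @ v \<or> x = u @ t \<and> t @ y = v"
      by (auto simp: append_eq_append_conv2)
    then show "p \<in> ?r1 \<union> ?r2"
    proof
      assume t: "x @ t = u \<and> y = t @ v"
      then have "(\<theta> `` {x}, \<theta> `` {t}) \<in> factorizations \<theta> u" unfolding factorizations_def by blast
      then show ?thesis using t xy(1) by (force simp: mult_quotient_monoid[OF assms])
    next
      assume t: "x = u @ t \<and> t @ y = v"
      then have "(\<theta> `` {t}, \<theta> `` {y}) \<in> factorizations \<theta> v" unfolding factorizations_def by blast
      then show ?thesis using t xy(1) by (force simp: mult_quotient_monoid[OF assms])
    qed
  qed
  show "?r1 \<union> ?r2 \<subseteq> ?l"
    unfolding factorizations_def by (force simp: mult_quotient_monoid[OF assms])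
qed

lemma refine_finite_congruences:
  assumes "\<theta> \<in> finite_congruences"
  shows "refine \<theta> \<in> finite_congruences"
proof (rule finite_congruencesI[where f = "factorizations \<theta>"])
  note c = finite_congruencesD[OF assms]
  have cls: "\<theta> `` {u} = \<theta> `` {v}" if "factorizations \<theta> u = factorizations \<theta> v" for u v
  proof -
    have *: "(\<theta> `` {[]}, \<theta> `` {u}) \<in> factorizations \<theta> u" unfolding factorizations_def by auto
    from * have "(\<theta> `` {[]}, \<theta> `` {u}) \<in> factorizations \<theta> v" unfolding that .
    from factorizations_class[OF c(1) *] factorizations_class[OF c(1) this] show ?thesis by simp
  qed
  have app: "factorizations \<theta> (u @ v) = factorizations \<theta> (u' @ v')"
    if "factorizations \<theta> u = factorizations \<theta> u'" "factorizations \<theta> v = factorizations \<theta> v'" for u u' v v'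
    unfolding factorizations_append[OF c(1)] that cls[OF that(1)] cls[OF that(2)] ..
  show "list_congruence (refine \<theta>)"
    by (rule list_congruenceI; unfold refine_def mem_Collect_eq prod.case)
      (rule refl sym trans app; assumption)+
  have "range (factorizations \<theta>) \<subseteq> Pow (range (\<lambda>w. \<theta> `` {w}) \<times> range (\<lambda>w. \<theta> `` {w}))"
    unfolding factorizations_def by auto
  then show "finite (range (factorizations \<theta>))"
    by (rule finite_subset) (use c(2) in auto)
qed (simp add: refine_def)

lemma refine_append:
  assumes "list_congruence \<theta>" "(u @ v, w) \<in> refine \<theta>"
  obtains u' v' where "w = u' @ v'" "(u, u') \<in> \<theta>" "(v, v') \<in> \<theta>"
proof -
  have "(\<theta> `` {u}, \<theta> `` {v}) \<in> factorizations \<theta> w"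
    using assms(2) unfolding refine_def factorizations_def by blast
  then show ?thesis
    using that congruence_class_eq_iff[OF assms(1)] unfolding factorizations_def by blast
qed

lemma refine_subset:
  assumes "list_congruence \<theta>"
  shows "refine \<theta> \<subseteq> \<theta>"
proof (rule subrelI)
  fix u w assume "(u, w) \<in> refine \<theta>"
  then have "([] @ u, w) \<in> refine \<theta>" by simp
  then obtain u' v' where "w = u' @ v'" "([], u') \<in> \<theta>" "(u, v') \<in> \<theta>" by (rule refine_append[OF assms])
  then show "(u, w) \<in> \<theta>" using list_congruence_append[OF assms, of "[]" u' u v'] by simp
qed


section \<open>The free profinite monoid\<close>

lemma profinite_cases:
  assumes "x \<in> carrier profinite_monoid" "\<theta> \<in> finite_congruences"
  obtains w where "x \<theta> = \<theta> `` {w}"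
proof -
  have "x \<theta> \<in> carrier (quotient_monoid \<theta>)"
    using assms unfolding profinite_monoid_def by (auto simp: PiE_iff)
  then show ?thesis using that by (rule quotient_monoid_cases)
qed

lemma profinite_coarsen:
  assumes x: "x \<in> carrier profinite_monoid" and \<theta>: "\<theta> \<in> finite_congruences" "\<theta>' \<in> finite_congruences" "\<theta> \<subseteq> \<theta>'"
    and w: "w \<in> x \<theta>"
  shows "w \<in> x \<theta>'"
proof -
  have "x \<theta> \<subseteq> x \<theta>'" using x \<theta> unfolding profinite_monoid_def by simp
  with w show ?thesis by blast
qed

text \<open>\<open>w \<in> x \<theta>\<close> is the working form of "\<open>w\<close> agrees with
  \<open>x\<close> modulo \<open>\<theta>\<close>": calculations in the profinite monoid are done on
  such words.\<close>

lemma profinite_class_iff: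
  assumes "x \<in> carrier profinite_monoid" "\<theta> \<in> finite_congruences"
  shows "w \<in> x \<theta> \<longleftrightarrow> x \<theta> = \<theta> `` {w}"
proof -
  obtain v where v: "x \<theta> = \<theta> `` {v}" using profinite_cases[OF assms] .
  note c = finite_congruencesD(1)[OF assms(2)]
  show ?thesis unfolding v congruence_class_eq_iff[OF c] by auto
qed

lemma profinite_nonempty:
  assumes "x \<in> carrier profinite_monoid" "\<theta> \<in> finite_congruences"
  obtains w where "w \<in> x \<theta>"
  using profinite_cases[OF assms] profinite_class_iff[OF assms] by metis

lemma profinite_carrierI:
  assumes "x \<in> extensional finite_congruences"
    and "\<And>\<theta>. \<theta> \<in> finite_congruences \<Longrightarrow> \<exists>w. x \<theta> = \<theta> `` {w}"
    and "\<And>\<theta> \<theta>'. \<theta> \<in> finite_congruences \<Longrightarrow> \<theta>' \<in> finite_congruences \<Longrightarrow> \<theta> \<subseteq> \<theta>' \<Longrightarrow> x \<theta> \<subseteq> x \<theta>'"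
  shows "x \<in> carrier profinite_monoid"
proof -
  have "x \<theta> \<in> carrier (quotient_monoid \<theta>)" if "\<theta> \<in> finite_congruences" for \<theta>
    using assms(2)[OF that] by auto
  then show ?thesis using assms(1,3) unfolding profinite_monoid_def by (simp add: PiE_def)
qed

lemma profinite_eqI:
  assumes "x \<in> carrier profinite_monoid" "y \<in> carrier profinite_monoid"
    and "\<And>\<theta>. \<theta> \<in> finite_congruences \<Longrightarrow> x \<theta> = y \<theta>"
  shows "x = y"
  using assms unfolding profinite_monoid_def by (auto intro: PiE_ext)

lemma profinite_mult:
  "\<theta> \<in> finite_congruences \<Longrightarrow> (x \<otimes>\<^bsub>profinite_monoid\<^esub> y) \<theta> = x \<theta> \<otimes>\<^bsub>quotient_monoid \<theta>\<^esub> y \<theta>"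
  unfolding profinite_monoid_def by simp

lemma profinite_mult_class:
  assumes "x \<in> carrier profinite_monoid" "y \<in> carrier profinite_monoid" "\<theta> \<in> finite_congruences"
    "u \<in> x \<theta>" "v \<in> y \<theta>"
  shows "(x \<otimes>\<^bsub>profinite_monoid\<^esub> y) \<theta> = \<theta> `` {u @ v}"
proof -
  have "x \<theta> = \<theta> `` {u}" "y \<theta> = \<theta> `` {v}" using profinite_class_iff assms by metis+
  then show ?thesis using profinite_mult[OF assms(3)] mult_quotient_monoid[OF finite_congruencesD(1)[OF assms(3)]] by metis
qed

lemma profinite_mult_closed:
  assumes "x \<in> carrier profinite_monoid" "y \<in> carrier profinite_monoid"
  shows "x \<otimes>\<^bsub>profinite_monoid\<^esub> y \<in> carrier profinite_monoid"
proof (rule profinite_carrierI)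
  show "x \<otimes>\<^bsub>profinite_monoid\<^esub> y \<in> extensional finite_congruences"
    unfolding profinite_monoid_def by simp
  show "\<exists>w. (x \<otimes>\<^bsub>profinite_monoid\<^esub> y) \<theta> = \<theta> `` {w}" if "\<theta> \<in> finite_congruences" for \<theta>
    using profinite_nonempty[OF assms(1) that] profinite_nonempty[OF assms(2) that]
      profinite_mult_class[OF assms that] by metis
  show "(x \<otimes>\<^bsub>profinite_monoid\<^esub> y) \<theta> \<subseteq> (x \<otimes>\<^bsub>profinite_monoid\<^esub> y) \<theta>'"
    if \<theta>: "\<theta> \<in> finite_congruences" "\<theta>' \<in> finite_congruences" "\<theta> \<subseteq> \<theta>'" for \<theta> \<theta>'
  proof -
    obtain u v where uv: "u \<in> x \<theta>" "v \<in> y \<theta>"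
      using profinite_nonempty[OF assms(1) \<theta>(1)] profinite_nonempty[OF assms(2) \<theta>(1)] by metis
    then have "u \<in> x \<theta>'" "v \<in> y \<theta>'" using profinite_coarsen[OF _ \<theta>] assms by blast+
    then show ?thesis using profinite_mult_class[OF assms] uv \<theta> by (metis Image_mono order_refl)
  qed
qed

lemma of_word_in_profinite: "of_word w \<in> carrier profinite_monoid"
  by (rule profinite_carrierI) (auto simp: of_word_def)

lemma of_word_class: "\<theta> \<in> finite_congruences \<Longrightarrow> of_word w \<theta> = \<theta> `` {w}"
  unfolding of_word_def by simp

lemma one_profinite: "\<one>\<^bsub>profinite_monoid\<^esub> = of_word []"
  unfolding profinite_monoid_def of_word_def by (simp add: one_quotient_monoid)

lemma plain_monoid_profinite: "plain_monoid profinite_monoid"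
  unfolding plain_monoid_def
proof (rule monoidI)
  have q: "monoid (quotient_monoid \<theta>)" if "\<theta> \<in> finite_congruences" for \<theta> :: "'a list rel"
    using plain_monoid_quotient_monoid[OF finite_congruencesD(1)[OF that]] unfolding plain_monoid_def .
  have in_q: "x \<theta> \<in> carrier (quotient_monoid \<theta>)"
    if "x \<in> carrier profinite_monoid" "\<theta> \<in> finite_congruences" for x and \<theta> :: "'a list rel"
    using that unfolding profinite_monoid_def by (auto simp: PiE_iff)
  have one: "\<one>\<^bsub>profinite_monoid\<^esub> \<theta> = \<one>\<^bsub>quotient_monoid \<theta>\<^esub>" if "\<theta> \<in> finite_congruences" for \<theta> :: "'a list rel"
    using that by (simp add: one_profinite of_word_def one_quotient_monoid)
  show closed: "x \<otimes>\<^bsub>profinite_monoid\<^esub> y \<in> carrier profinite_monoid"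
    if "x \<in> carrier profinite_monoid" "y \<in> carrier profinite_monoid" for x y :: "'a profinite"
    using profinite_mult_closed that .
  show one_in: "\<one>\<^bsub>profinite_monoid\<^esub> \<in> (carrier profinite_monoid :: 'a profinite set)"
    by (simp add: one_profinite of_word_in_profinite)
  fix x y z :: "'a profinite"
  assume x: "x \<in> carrier profinite_monoid"
  show "\<one>\<^bsub>profinite_monoid\<^esub> \<otimes>\<^bsub>profinite_monoid\<^esub> x = x" "x \<otimes>\<^bsub>profinite_monoid\<^esub> \<one>\<^bsub>profinite_monoid\<^esub> = x"
    by (rule profinite_eqI;
        simp add: closed one_in x profinite_mult one monoid.l_one[OF q in_q] monoid.r_one[OF q in_q])+
  assume y: "y \<in> carrier profinite_monoid" and z: "z \<in> carrier profinite_monoid"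
  show "x \<otimes>\<^bsub>profinite_monoid\<^esub> y \<otimes>\<^bsub>profinite_monoid\<^esub> z = x \<otimes>\<^bsub>profinite_monoid\<^esub> (y \<otimes>\<^bsub>profinite_monoid\<^esub> z)"
    by (rule profinite_eqI) (simp_all add: closed x y z profinite_mult monoid.m_assoc[OF q in_q in_q in_q])
qed

lemma topspace_profinite: "topspace profinite_topology = carrier profinite_monoid"
  unfolding profinite_topology_def profinite_monoid_def by auto

lemma openin_profinite_basic:
  assumes \<theta>: "\<theta> \<in> finite_congruences"
  shows "openin profinite_topology {y \<in> carrier profinite_monoid. y \<theta> \<in> S}"
proof -
  have "continuous_map profinite_topology (discrete_topology (carrier (quotient_monoid \<theta>))) (\<lambda>x. x \<theta>)"
    unfolding profinite_topology_def
    by (rule continuous_map_from_subtopology) (rule continuous_map_product_coordinates[OF \<theta>])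
  then have "openin profinite_topology {y \<in> topspace profinite_topology. y \<theta> \<in> S \<inter> carrier (quotient_monoid \<theta>)}"
    unfolding continuous_map_def by auto
  moreover have "{y \<in> topspace profinite_topology. y \<theta> \<in> S \<inter> carrier (quotient_monoid \<theta>)} =
      {y \<in> carrier profinite_monoid. y \<theta> \<in> S}"
    unfolding topspace_profinite using \<theta> unfolding profinite_monoid_def by (auto simp: PiE_iff)
  ultimately show ?thesis by simp
qed

text \<open>A basic open set restricts finitely many coordinates. Their intersection is again a
  congruence of finite index, and its coordinate determines all of them.\<close>

lemma openin_profinite_nbhd:
  assumes "openin profinite_topology T" "x \<in> T"
  shows "\<exists>\<theta>\<in>finite_congruences. \<forall>y\<in>carrier profinite_monoid. y \<theta> = x \<theta> \<longrightarrow> y \<in> T"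
proof -
  obtain T' where T': "openin (product_topology (\<lambda>\<theta>. discrete_topology (carrier (quotient_monoid \<theta>))) finite_congruences) T'"
      "T = T' \<inter> carrier profinite_monoid"
    using assms(1) unfolding profinite_topology_def openin_subtopology by blast
  then obtain V where V: "finite {\<theta> \<in> finite_congruences. V \<theta> \<noteq> carrier (quotient_monoid \<theta>)}"
      "x \<in> Pi\<^sub>E finite_congruences V" "Pi\<^sub>E finite_congruences V \<subseteq> T'"
    using assms(2) unfolding openin_product_topology_alt by auto
  let ?S = "{\<theta> \<in> finite_congruences. V \<theta> \<noteq> carrier (quotient_monoid \<theta>)}"
  have xc: "x \<in> carrier profinite_monoid" using assms(2) T'(2) by blast
  have \<theta>: "\<Inter>?S \<in> finite_congruences" by (rule finite_congruences_INT[OF V(1)]) auto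
  have "y \<in> T" if y: "y \<in> carrier profinite_monoid" "y (\<Inter>?S) = x (\<Inter>?S)" for y
  proof -
    obtain w where w: "w \<in> x (\<Inter>?S)" using profinite_nonempty[OF xc \<theta>] .
    have "y \<eta> \<in> V \<eta>" if \<eta>: "\<eta> \<in> finite_congruences" for \<eta>
    proof (cases "\<eta> \<in> ?S")
      case True
      then have sub: "\<Inter>?S \<subseteq> \<eta>" by blast
      have "w \<in> x \<eta>" "w \<in> y \<eta>"
        using profinite_coarsen[OF xc \<theta> \<eta> sub] profinite_coarsen[OF y(1) \<theta> \<eta> sub] w y(2) by auto
      then have "y \<eta> = x \<eta>" using profinite_class_iff[OF xc \<eta>] profinite_class_iff[OF y(1) \<eta>] by simp
      then show ?thesis using V(2) \<eta> by auto
    next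
      case False
      then show ?thesis using y(1) \<eta> unfolding profinite_monoid_def by (auto simp: PiE_iff)
    qed
    then have "y \<in> Pi\<^sub>E finite_congruences V" using y(1) unfolding profinite_monoid_def by (auto simp: PiE_iff)
    then show ?thesis using V(3) T'(2) y(1) by blast
  qed
  with \<theta> show ?thesis by blast
qed

text \<open>This turns the closure into a condition on words, one congruence at a time; afterwards
  the topology appears only in the identification of \<open>syntactic_hom_ext\<close>.\<close>

lemma in_profinite_closure:
  "x \<in> profinite_closure Y \<longleftrightarrow>
     x \<in> carrier profinite_monoid \<and> (\<forall>\<theta>\<in>finite_congruences. \<exists>w\<in>Y. w \<in> x \<theta>)"
proof (intro iffI conjI ballI)
  assume x: "x \<in> profinite_closure Y"
  then show xc: "x \<in> carrier profinite_monoid"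
    unfolding profinite_closure_def in_closure_of topspace_profinite by blast
  fix \<theta> :: "'a list rel" assume \<theta>: "\<theta> \<in> finite_congruences"
  have "\<And>T. x \<in> T \<and> openin profinite_topology T \<Longrightarrow> \<exists>y. y \<in> of_word ` Y \<and> y \<in> T"
    using x unfolding profinite_closure_def in_closure_of by simp
  from this[OF conjI[OF _ openin_profinite_basic[OF \<theta>, of "{x \<theta>}"]]]
  obtain w where w: "w \<in> Y" "of_word w \<theta> = x \<theta>" using xc by auto
  then show "\<exists>w\<in>Y. w \<in> x \<theta>" using profinite_class_iff[OF xc \<theta>] of_word_class[OF \<theta>] by metis
next
  assume x: "x \<in> carrier profinite_monoid \<and> (\<forall>\<theta>\<in>finite_congruences. \<exists>w\<in>Y. w \<in> x \<theta>)"
  show "x \<in> profinite_closure Y"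
    unfolding profinite_closure_def in_closure_of topspace_profinite
  proof (intro conjI allI impI)
    show "x \<in> carrier profinite_monoid" using x by blast
    fix T assume T: "x \<in> T \<and> openin profinite_topology T"
    obtain \<theta> where \<theta>: "\<theta> \<in> finite_congruences" "\<forall>y\<in>carrier profinite_monoid. y \<theta> = x \<theta> \<longrightarrow> y \<in> T"
      using openin_profinite_nbhd[OF conjunct2[OF T] conjunct1[OF T]] ..
    obtain w where "w \<in> Y" "w \<in> x \<theta>" using x \<theta>(1) by blast
    then show "\<exists>y. y \<in> of_word ` Y \<and> y \<in> T"
      using \<theta> profinite_class_iff[of x \<theta> w] x of_word_class[OF \<theta>(1)] of_word_in_profinite by (metis imageI)
  qed
qed

lemma profinite_closure_factorial:
  assumes F: "factorial_set F"
  shows "factors_of profinite_monoid (profinite_closure F) \<subseteq> profinite_closure F"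
proof -
  have 1: "x \<in> profinite_closure F" "y \<in> profinite_closure F"
    if xy: "x \<in> carrier profinite_monoid" "y \<in> carrier profinite_monoid"
      "x \<otimes>\<^bsub>profinite_monoid\<^esub> y \<in> profinite_closure F" for x y
  proof -
    have "\<exists>u v. u \<in> F \<and> v \<in> F \<and> u \<in> x \<theta> \<and> v \<in> y \<theta>" if \<theta>: "\<theta> \<in> finite_congruences" for \<theta>
    proof -
      note c = finite_congruencesD(1)[OF \<theta>]
      note r = refine_finite_congruences[OF \<theta>]
      obtain u v where uv: "u \<in> x (refine \<theta>)" "v \<in> y (refine \<theta>)"
        using profinite_nonempty[OF xy(1) r] profinite_nonempty[OF xy(2) r] by metis
      \<comment> \<open>A word of \<open>F\<close> approximating the product modulo
        \<open>refine \<theta>\<close> can itself be cut into approximations of \<open>x\<close> and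
        \<open>y\<close> modulo \<open>\<theta>\<close>, and both halves are factors of it.\<close>
      obtain w where w: "w \<in> F" "w \<in> (x \<otimes>\<^bsub>profinite_monoid\<^esub> y) (refine \<theta>)"
        using xy(3) r unfolding in_profinite_closure by blast
      then have "(u @ v, w) \<in> refine \<theta>" using profinite_mult_class[OF xy(1,2) r uv] by auto
      then obtain u' v' where u': "w = u' @ v'" "(u, u') \<in> \<theta>" "(v, v') \<in> \<theta>" by (rule refine_append[OF c])
      have "u \<in> x \<theta>" "v \<in> y \<theta>" using profinite_coarsen[OF _ r \<theta> refine_subset[OF c]] uv xy by blast+
      then have "u' \<in> x \<theta>" "v' \<in> y \<theta>" using u'(2,3) profinite_class_iff[OF _ \<theta>] xy by auto
      moreover have "u' \<in> F" "v' \<in> F"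
        using factorial_set_prefixD[OF F] factorial_set_suffixD[OF F] w(1) u'(1) by blast+
      ultimately show ?thesis by blast
    qed
    then show "x \<in> profinite_closure F" "y \<in> profinite_closure F"
      unfolding in_profinite_closure using xy by blast+
  qed
  show ?thesis
  proof
    fix x :: "'a profinite" assume "x \<in> factors_of profinite_monoid (profinite_closure F)"
    then obtain u v where uv: "x \<in> carrier profinite_monoid" "u \<in> carrier profinite_monoid" "v \<in> carrier profinite_monoid"
      "u \<otimes>\<^bsub>profinite_monoid\<^esub> x \<otimes>\<^bsub>profinite_monoid\<^esub> v \<in> profinite_closure F" by (rule factors_ofE)
    show "x \<in> profinite_closure F"
      using 1(1)[OF profinite_mult_closed[OF uv(2,1)] uv(3,4)] 1(2)[OF uv(2,1)] by blast
  qed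
qed


section \<open>Limits of words along an ultrafilter\<close>

lemma ultrafilter_exists:
  fixes F :: "'b filter"
  assumes "F \<noteq> bot"
  obtains U where "U \<le> F" "U \<noteq> bot" "\<And>P. eventually P U \<or> eventually (\<lambda>x. \<not> P x) U"
proof -
  let ?A = "{G. G \<le> F \<and> G \<noteq> bot}"
  have "\<exists>U\<in>?A. \<forall>G\<in>?A. G \<le> U \<longrightarrow> G = U"
  proof (rule predicate_Zorn)
    show "partial_order_on ?A (relation_of (\<lambda>x y. y \<le> x) ?A)"
      by (rule partial_order_on_relation_ofI) auto
    fix C assume C: "C \<in> Chains (relation_of (\<lambda>x y. y \<le> x) ?A)"
    then have CA: "C \<subseteq> ?A" and chain: "\<And>G H. G \<in> C \<Longrightarrow> H \<in> C \<Longrightarrow> G \<le> H \<or> H \<le> G"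
      unfolding Chains_def relation_of_def by auto
    show "\<exists>U\<in>?A. \<forall>G\<in>C. U \<le> G"
    proof (cases "C = {}")
      case True
      then show ?thesis using assms by auto
    next
      case False
      \<comment> \<open>In a chain, what holds eventually for the infimum already does so for a
        member, so the infimum is still proper.\<close>
      have "eventually P (Inf C) \<longleftrightarrow> (\<exists>G\<in>C. eventually P G)" for P
        using chain by (intro eventually_Inf_base[OF False]) (metis inf.absorb1 inf.absorb2 order_refl)
      then have "Inf C \<noteq> bot" using CA unfolding trivial_limit_def by auto
      moreover have "Inf C \<le> F" using CA False by (metis (mono_tags, lifting) Inf_lower2 ex_in_conv mem_Collect_eq subsetD)
      ultimately show ?thesis by (auto intro: Inf_lower)
    qed
  qed
  then obtain U where U: "U \<le> F" "U \<noteq> bot" "\<And>G. G \<le> F \<Longrightarrow> G \<noteq> bot \<Longrightarrow> G \<le> U \<Longrightarrow> G = U" by auto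
  \<comment> \<open>Restricting \<open>U\<close> to \<open>P\<close> gives either the improper
    filter, so that the negation of \<open>P\<close> holds eventually, or by minimality
    \<open>U\<close> itself.\<close>
  have "eventually P U \<or> eventually (\<lambda>x. \<not> P x) U" for P
  proof (cases "inf U (principal {x. P x}) = bot")
    case True
    then have "eventually (\<lambda>x. False) (inf U (principal {x. P x}))" by simp
    then show ?thesis unfolding eventually_inf_principal by simp
  next
    case False
    have "inf U (principal {x. P x}) = U"
    proof (rule U(3)[OF _ False])
      show "inf U (principal {x. P x}) \<le> F" using U(1) by (rule le_infI1)
    qed simp
    moreover have "eventually P (inf U (principal {x. P x}))" unfolding eventually_inf_principal by simp
    ultimately show ?thesis by simp
  qed
  with U(1,2) show thesis using that by blast
qed

text \<open>The filter "for all sufficiently fine congruences of finite index"; these are directed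
  because intersections stay of finite index.\<close>

definition congruence_filter :: "'a list rel filter" where
  "congruence_filter = (INF \<theta>\<in>finite_congruences. principal {\<theta>' \<in> finite_congruences. \<theta>' \<subseteq> \<theta>})"

lemma eventually_congruence_filter:
  "eventually P congruence_filter \<longleftrightarrow>
     (\<exists>\<theta>\<in>finite_congruences. \<forall>\<theta>'\<in>finite_congruences. \<theta>' \<subseteq> \<theta> \<longrightarrow> P \<theta>')"
  unfolding congruence_filter_def
proof (subst eventually_INF_base)
  show "finite_congruences \<noteq> {}" using finite_congruences_UNIV by blast
  fix \<theta> \<theta>' :: "'a list rel" assume "\<theta> \<in> finite_congruences" "\<theta>' \<in> finite_congruences"
  then show "\<exists>\<eta>\<in>finite_congruences. principal {\<theta>' \<in> finite_congruences. \<theta>' \<subseteq> \<eta>} \<le>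
      inf (principal {\<theta>' \<in> finite_congruences. \<theta>' \<subseteq> \<theta>}) (principal {\<theta>'' \<in> finite_congruences. \<theta>'' \<subseteq> \<theta>'})"
    by (intro bexI[of _ "\<theta> \<inter> \<theta>'"]) (auto simp: finite_congruences_Int)
qed (simp add: eventually_principal Ball_def imp_conjL)

text \<open>Limits of families of words along an ultrafilter replace the compactness of the free
  profinite monoid. The first index makes words of growing length available.\<close>

locale congruence_ultrafilter =
  fixes U :: "(nat \<times> 'a list rel) filter"
  assumes U_le: "U \<le> sequentially \<times>\<^sub>F congruence_filter" and U_nontrivial: "U \<noteq> bot"
    and ultra: "eventually P U \<or> eventually (\<lambda>j. \<not> P j) U"
begin

definition ulim :: "(nat \<times> 'a list rel \<Rightarrow> 'a list) \<Rightarrow> 'a profinite" where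
  "ulim w = (\<lambda>\<theta>\<in>finite_congruences. {v. eventually (\<lambda>j. (v, w j) \<in> \<theta>) U})"

lemma eventually_index:
  assumes "\<theta> \<in> finite_congruences"
  shows "eventually (\<lambda>j. fst j \<ge> n \<and> snd j \<in> finite_congruences \<and> snd j \<subseteq> \<theta>) U"
proof -
  have "eventually (\<lambda>\<theta>'. \<theta>' \<in> finite_congruences \<and> \<theta>' \<subseteq> \<theta>) congruence_filter"
    unfolding eventually_congruence_filter using assms by blast
  from eventually_prodI[OF eventually_ge_at_top[of n] this]
  show ?thesis using U_le by (auto simp: le_filter_def)
qed

text \<open>If the ultrafilter rejected each of the finitely many values, it would reject them all
  at once.\<close>

lemma eventually_constant:
  assumes "finite S" "\<And>j. f j \<in> S"
  shows "\<exists>c. eventually (\<lambda>j. f j = c) U"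
proof (rule ccontr)
  assume "\<nexists>c. eventually (\<lambda>j. f j = c) U"
  then have "eventually (\<lambda>j. f j \<noteq> c) U" for c using ultra[of "\<lambda>j. f j = c"] by blast
  then have "eventually (\<lambda>j. \<forall>c\<in>S. f j \<noteq> c) U" using assms(1) by (simp add: eventually_ball_finite)
  then have "eventually (\<lambda>j. False) U" by (rule eventually_mono) (use assms(2) in blast)
  then show False using U_nontrivial by simp
qed

lemma ulim_class:
  assumes \<theta>: "\<theta> \<in> finite_congruences"
  shows "eventually (\<lambda>j. ulim w \<theta> = \<theta> `` {w j}) U"
proof -
  note c = finite_congruencesD[OF \<theta>]
  obtain C where C: "eventually (\<lambda>j. \<theta> `` {w j} = C) U"
    using eventually_constant[OF c(2), of "\<lambda>j. \<theta> `` {w j}"] by blast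
  have "v \<in> C \<longleftrightarrow> eventually (\<lambda>j. (v, w j) \<in> \<theta>) U" for v
  proof
    assume "v \<in> C"
    show "eventually (\<lambda>j. (v, w j) \<in> \<theta>) U"
      using C by (rule eventually_mono) (use \<open>v \<in> C\<close> list_congruence_sym[OF c(1)] in blast)
  next
    assume "eventually (\<lambda>j. (v, w j) \<in> \<theta>) U"
    from eventually_conj[OF this C] obtain j where "(v, w j) \<in> \<theta>" "\<theta> `` {w j} = C"
      using eventually_happens'[OF U_nontrivial] by blast
    then show "v \<in> C" using list_congruence_sym[OF c(1)] by blast
  qed
  then have "ulim w \<theta> = C" using \<theta> unfolding ulim_def by auto
  then show ?thesis using C by (auto elim: eventually_mono)
qed

lemma ulim_in_profinite: "ulim w \<in> carrier profinite_monoid"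
proof (rule profinite_carrierI)
  show "ulim w \<in> extensional finite_congruences" unfolding ulim_def by simp
  show "\<exists>v. ulim w \<theta> = \<theta> `` {v}" if "\<theta> \<in> finite_congruences" for \<theta>
    using eventually_happens'[OF U_nontrivial ulim_class[OF that]] by blast
  show "ulim w \<theta> \<subseteq> ulim w \<theta>'"
    if \<theta>: "\<theta> \<in> finite_congruences" "\<theta>' \<in> finite_congruences" "\<theta> \<subseteq> \<theta>'" for \<theta> \<theta>'
  proof -
    obtain j where "ulim w \<theta> = \<theta> `` {w j}" "ulim w \<theta>' = \<theta>' `` {w j}"
      using eventually_happens'[OF U_nontrivial
          eventually_conj[OF ulim_class[OF \<theta>(1), of w] ulim_class[OF \<theta>(2), of w]]] by auto
    then show ?thesis using \<theta>(3) by auto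
  qed
qed

lemma ulim_eqI:
  assumes "x \<in> carrier profinite_monoid"
    and "\<And>\<theta>. \<theta> \<in> finite_congruences \<Longrightarrow> eventually (\<lambda>j. w j \<in> x \<theta>) U"
  shows "ulim w = x"
proof (rule profinite_eqI[OF ulim_in_profinite assms(1)])
  fix \<theta> :: "'a list rel" assume \<theta>: "\<theta> \<in> finite_congruences"
  obtain j where "ulim w \<theta> = \<theta> `` {w j}" "w j \<in> x \<theta>"
    using eventually_happens'[OF U_nontrivial eventually_conj[OF ulim_class[OF \<theta>, of w] assms(2)[OF \<theta>]]]
    by auto
  then show "ulim w \<theta> = x \<theta>" using profinite_class_iff[OF assms(1) \<theta>] by simp
qed

text \<open>The second index is itself a congruence and eventually refines any given one; so at
  index \<open>j\<close> it is enough to approximate \<open>x\<close> modulo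
  \<open>snd j\<close>.\<close>

lemma ulim_approximation:
  assumes x: "x \<in> carrier profinite_monoid" and w: "\<And>j. snd j \<in> finite_congruences \<Longrightarrow> w j \<in> x (snd j)"
  shows "ulim w = x"
proof (rule ulim_eqI[OF x])
  show "eventually (\<lambda>j. w j \<in> x \<theta>) U" if \<theta>: "\<theta> \<in> finite_congruences" for \<theta>
    using eventually_index[OF \<theta>, of 0]
    by (rule eventually_mono) (use profinite_coarsen[OF x _ \<theta>] w in blast)
qed

lemma ulim_append: "ulim (\<lambda>j. u j @ v j) = ulim u \<otimes>\<^bsub>profinite_monoid\<^esub> ulim v"
proof (rule ulim_eqI[OF profinite_mult_closed[OF ulim_in_profinite ulim_in_profinite]])
  fix \<theta> :: "'a list rel" assume \<theta>: "\<theta> \<in> finite_congruences"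
  have cl: "w \<in> \<theta> `` {w}" for w using list_congruence_refl[OF finite_congruencesD(1)[OF \<theta>]] by simp
  show "eventually (\<lambda>j. u j @ v j \<in> (ulim u \<otimes>\<^bsub>profinite_monoid\<^esub> ulim v) \<theta>) U"
    using eventually_conj[OF ulim_class[OF \<theta>, of u] ulim_class[OF \<theta>, of v]]
  proof (rule eventually_mono)
    fix j assume "ulim u \<theta> = \<theta> `` {u j} \<and> ulim v \<theta> = \<theta> `` {v j}"
    then have "u j \<in> ulim u \<theta>" "v j \<in> ulim v \<theta>" using cl by simp_all
    from profinite_mult_class[OF ulim_in_profinite ulim_in_profinite \<theta> this]
    show "u j @ v j \<in> (ulim u \<otimes>\<^bsub>profinite_monoid\<^esub> ulim v) \<theta>" using cl by simp
  qed
qed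

end

lemma congruence_ultrafilter_exists:
  "\<exists>U :: (nat \<times> 'a list rel) filter. congruence_ultrafilter U"
proof -
  have "(congruence_filter :: 'a list rel filter) \<noteq> bot"
    unfolding trivial_limit_def eventually_congruence_filter by blast
  then have "(sequentially \<times>\<^sub>F congruence_filter :: (nat \<times> 'a list rel) filter) \<noteq> bot"
    by (simp add: prod_filter_eq_bot)
  then show ?thesis
    by (rule ultrafilter_exists) (auto intro: congruence_ultrafilter.intro)
qed

text \<open>Ramsey's theorem, applied to the factors of an infinite sequence of words of \<open>F\<close>, each
  extending the previous one by a letter to the left.\<close>

lemma idempotent_word:
  assumes F: "recurrent F" and \<theta>: "\<theta> \<in> finite_congruences"
  shows "\<exists>w\<in>F. n \<le> length w \<and> (w @ w, w) \<in> \<theta>"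
proof -
  note c = finite_congruencesD[OF \<theta>]
  have fac: "factorial_set F" using F unfolding recurrent_def by blast
  have "\<exists>x. \<forall>k. (x k \<in> F \<and> length (x k) = k) \<and> x k = tl (x (Suc k))"
  proof (rule dependent_nat_choice)
    show "\<exists>x. x \<in> F \<and> length x = 0" using recurrent_Nil[OF F] by auto
    fix x k assume x: "x \<in> F \<and> length x = k"
    obtain c where "c # x \<in> F" using recurrent_left_ext[OF F] x by blast
    then show "\<exists>y. (y \<in> F \<and> length y = Suc k) \<and> x = tl y" using x by (intro exI[of _ "c # x"]) simp
  qed
  then obtain x where x: "\<And>k. x k \<in> F" "\<And>k. length (x k) = k" "\<And>k. x k = tl (x (Suc k))" by blast
  have suf: "x k = drop d (x (k + d))" for k d
  proof (induction d)
    case (Suc d)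
    also have "x (k + d) = tl (x (Suc (k + d)))" by (rule x(3))
    finally show ?case by (simp only: drop_Suc add_Suc_right)
  qed simp
  \<comment> \<open>For \<open>i \<le> j\<close> the word \<open>x j\<close> is
    \<open>b i j @ x i\<close>. As the words grow to the left, consecutive pieces multiply in the
    reverse order.\<close>
  define b where "b i j = take (j - i) (x j)" for i j
  have b_app: "b j k @ b i j = b i k" if "i \<le> j" "j \<le> k" for i j k
  proof -
    have "x j = drop (k - j) (x k)" using suf[of j "k - j"] that by simp
    then have "b i j = take (j - i) (drop (k - j) (x k))" by (simp add: b_def)
    then show ?thesis using that take_add[of "k - j" "j - i" "x k"] by (simp add: b_def)
  qed
  have bF: "b i j \<in> F" for i j
    using factorial_set_prefixD[OF fac, of "b i j" "drop (j - i) (x j)"] x(1)[of j] by (simp add: b_def)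
  have len: "length (b i j) = j - i" for i j using x(2) by (simp add: b_def)
  define f where "f S = \<theta> `` {b (Min S) (Max S)}" for S :: "nat set"
  obtain g where g: "bij_betw g (range (\<lambda>w. \<theta> `` {w})) {0..<card (range (\<lambda>w. \<theta> `` {w}))}"
    using ex_bij_betw_finite_nat[OF c(2)] by blast
  have "\<forall>p\<in>UNIV. \<forall>q\<in>UNIV. p \<noteq> q \<longrightarrow> (g \<circ> f) {p, q} < card (range (\<lambda>w. \<theta> `` {w}))"
    using g unfolding f_def bij_betw_def by auto
  from Ramsey2[OF infinite_UNIV_nat this] obtain Y t where
    Y: "infinite Y" "\<And>p q. p \<in> Y \<Longrightarrow> q \<in> Y \<Longrightarrow> p \<noteq> q \<Longrightarrow> g (f {p, q}) = t" by auto
  obtain i where i: "i \<in> Y" using Y(1) by (metis ex_in_conv finite.emptyI)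
  \<comment> \<open>The gap \<open>n\<close> makes \<open>b i k\<close> long enough. The classes of
    \<open>b i j\<close>, \<open>b j k\<close> and \<open>b i k\<close> coincide and
    \<open>b j k @ b i j = b i k\<close>, so this class is idempotent.\<close>
  obtain j where j: "j \<in> Y" "j > i + n" using Y(1) unfolding infinite_nat_iff_unbounded by blast
  obtain k where k: "k \<in> Y" "k > j" using Y(1) unfolding infinite_nat_iff_unbounded by blast
  have "g (\<theta> `` {b i j}) = t" "g (\<theta> `` {b j k}) = t" "g (\<theta> `` {b i k}) = t"
    using Y(2)[of i j] Y(2)[of j k] Y(2)[of i k] i j k by (simp_all add: f_def)
  then have eq: "\<theta> `` {b i j} = \<theta> `` {b i k}" "\<theta> `` {b j k} = \<theta> `` {b i k}"
    using inj_onD[OF bij_betw_imp_inj_on[OF g]] by (metis rangeI)+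
  have "\<theta> `` {b i k @ b i k} = \<theta> `` {b j k @ b i j}"
    using eq mult_quotient_monoid[OF c(1)] by metis
  also have "b j k @ b i j = b i k" using b_app j k by simp
  finally have "(b i k @ b i k, b i k) \<in> \<theta>" unfolding congruence_class_eq_iff[OF c(1)] .
  moreover have "length (b i k) \<ge> n" using len j k by simp
  ultimately show ?thesis using bF by blast
qed

text \<open>In a uniformly recurrent set every word occurs in every long word, so that the limits of
  words of unbounded length are \<open>J\<close>-equivalent and have all of \<open>profinite_closure F\<close> as factors.\<close>

proposition uniformly_recurrent_idempotent:
  assumes F: "uniformly_recurrent F"
  obtains e where "e \<in> carrier profinite_monoid" "e \<otimes>\<^bsub>profinite_monoid\<^esub> e = e"
    "profinite_closure F = factors_of profinite_monoid {e}"
    "\<forall>n. \<forall>\<theta>\<in>finite_congruences. \<exists>w\<in>F. n \<le> length w \<and> w \<in> e \<theta>"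
proof -
  have rec: "recurrent F" using F unfolding uniformly_recurrent_def by blast
  have fac: "factorial_set F" using rec unfolding recurrent_def by blast
  obtain U :: "(nat \<times> 'a list rel) filter" where "congruence_ultrafilter U"
    using congruence_ultrafilter_exists by blast
  then interpret congruence_ultrafilter U .
  interpret P: plain_monoid "profinite_monoid :: 'a profinite monoid" by (rule plain_monoid_profinite)
  \<comment> \<open>At each index the word is idempotent modulo the congruence and as long as the
    number demands; if the second component is not a congruence of finite index, only the length is
    asked for.\<close>
  have "\<exists>w. w \<in> F \<and> fst j \<le> length w \<and> (snd j \<in> finite_congruences \<longrightarrow> (w @ w, w) \<in> snd j)"
    for j :: "nat \<times> 'a list rel"
    using idempotent_word[OF rec, of "snd j" "fst j"] recurrent_long_word[OF rec, of "fst j"]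
    by (cases "snd j \<in> finite_congruences") auto
  then obtain w where w: "\<And>j. w j \<in> F" "\<And>j. fst j \<le> length (w j)"
      "\<And>j. snd j \<in> finite_congruences \<Longrightarrow> (w j @ w j, w j) \<in> snd j" by metis
  define e where "e = ulim w"
  have ec: "e \<in> carrier profinite_monoid" unfolding e_def by (rule ulim_in_profinite)
  have in_e: "eventually (\<lambda>j. w j \<in> e \<theta>) U" if "\<theta> \<in> finite_congruences" for \<theta>
    unfolding e_def using ulim_class[OF that, of w] list_congruence_refl[OF finite_congruencesD(1)[OF that]]
    by (auto elim: eventually_mono)
  have "ulim (\<lambda>j. w j @ w j) = e"
  proof (rule ulim_eqI[OF ec])
    fix \<theta> :: "'a list rel" assume \<theta>: "\<theta> \<in> finite_congruences"
    show "eventually (\<lambda>j. w j @ w j \<in> e \<theta>) U"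
      using eventually_conj[OF in_e[OF \<theta>] eventually_index[OF \<theta>, of 0]]
    proof (rule eventually_mono)
      fix j assume j: "w j \<in> e \<theta> \<and> 0 \<le> fst j \<and> snd j \<in> finite_congruences \<and> snd j \<subseteq> \<theta>"
      then have "(w j @ w j, w j) \<in> \<theta>" using w(3) by blast
      then have "(w j, w j @ w j) \<in> \<theta>" by (rule list_congruence_sym[OF finite_congruencesD(1)[OF \<theta>]])
      then show "w j @ w j \<in> e \<theta>" using j profinite_class_iff[OF ec \<theta>, of "w j"] by blast
    qed
  qed
  then have idem: "e \<otimes>\<^bsub>profinite_monoid\<^esub> e = e" unfolding ulim_append e_def .
  have long: "\<exists>v\<in>F. n \<le> length v \<and> v \<in> e \<theta>" if \<theta>: "\<theta> \<in> finite_congruences" for n \<theta>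
  proof -
    obtain j where "w j \<in> e \<theta>" "n \<le> fst j"
      using eventually_happens'[OF U_nontrivial eventually_conj[OF in_e[OF \<theta>] eventually_index[OF \<theta>, of n]]]
      by blast
    then show ?thesis using w(1,2) order_trans by blast
  qed
  have "profinite_closure F = factors_of profinite_monoid {e}"
  proof
    have "e \<in> profinite_closure F" unfolding in_profinite_closure using ec long by blast
    then have "factors_of profinite_monoid {e} \<subseteq> factors_of profinite_monoid (profinite_closure F)"
      unfolding factors_of_def by blast
    then show "factors_of profinite_monoid {e} \<subseteq> profinite_closure F"
      using profinite_closure_factorial[OF fac] by blast
    show "profinite_closure F \<subseteq> factors_of profinite_monoid {e}"
    proof
      fix y assume "y \<in> profinite_closure F"
      then have yc: "y \<in> carrier profinite_monoid" and y: "\<forall>\<theta>\<in>finite_congruences. \<exists>u\<in>F. u \<in> y \<theta>"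
        unfolding in_profinite_closure by blast+
      \<comment> \<open>The contexts \<open>p\<close> and \<open>q\<close> around an approximation
        of \<open>y\<close> are chosen index by index; their limits are the contexts that make
        \<open>y\<close> a factor of \<open>e\<close>.\<close>
      have "\<exists>p u q. snd j \<in> finite_congruences \<longrightarrow> u \<in> y (snd j) \<and> p @ u @ q \<in> e (snd j)"
        for j :: "nat \<times> 'a list rel"
      proof (cases "snd j \<in> finite_congruences")
        case True
        then obtain u where u: "u \<in> F" "u \<in> y (snd j)" using y by blast
        then obtain n where n: "\<And>x. x \<in> F \<Longrightarrow> n \<le> length x \<Longrightarrow> sublist u x"
          using F unfolding uniformly_recurrent_def by blast
        obtain v where "v \<in> F" "n \<le> length v" "v \<in> e (snd j)" using long[OF True] by blast
        then show ?thesis using n[of v] u(2) unfolding sublist_def by blast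
      qed blast
      then obtain p u q where "\<forall>j :: nat \<times> 'a list rel.
          snd j \<in> finite_congruences \<longrightarrow> u j \<in> y (snd j) \<and> p j @ u j @ q j \<in> e (snd j)" by metis
      then have puq: "snd j \<in> finite_congruences \<Longrightarrow> u j \<in> y (snd j)"
          "snd j \<in> finite_congruences \<Longrightarrow> p j @ u j @ q j \<in> e (snd j)" for j by blast+
      have "ulim (\<lambda>j. p j @ u j @ q j) = e" by (rule ulim_approximation[OF ec puq(2)])
      moreover have "ulim u = y" by (rule ulim_approximation[OF yc puq(1)])
      ultimately have "ulim p \<otimes>\<^bsub>profinite_monoid\<^esub> (y \<otimes>\<^bsub>profinite_monoid\<^esub> ulim q) = e"
        by (simp add: ulim_append)
      then have "ulim p \<otimes>\<^bsub>profinite_monoid\<^esub> y \<otimes>\<^bsub>profinite_monoid\<^esub> ulim q \<in> {e}"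
        using P.m_assoc[OF ulim_in_profinite yc ulim_in_profinite] by simp
      then show "y \<in> factors_of profinite_monoid {e}"
        using ulim_in_profinite yc by (intro factors_ofI)
    qed
  qed
  with ec idem long show thesis using that by blast
qed

section \<open>The class J(F) and its image in the syntactic monoid\<close>

lemma J_of_eq:
  assumes e: "e \<in> carrier profinite_monoid" "e \<otimes>\<^bsub>profinite_monoid\<^esub> e = e"
    and F: "profinite_closure F = factors_of profinite_monoid {e}"
  shows "J_of F = J_class_of profinite_monoid e"
  unfolding J_of_def
proof (rule the_equality)
  interpret P: plain_monoid "profinite_monoid :: 'a profinite monoid" by (rule plain_monoid_profinite)
  let ?M = "profinite_monoid :: 'a profinite monoid"
  show "regular_J_class ?M (J_class_of ?M e) \<and> J_class_of ?M e \<subseteq> profinite_closure F \<and>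
      profinite_closure F = factors_of ?M (J_class_of ?M e)"
    unfolding P.factors_of_J_class[OF e(1)] F
    using regular_J_classI[OF e P.J_class_of_self[OF e(1)]] unfolding J_class_of_def by blast
  \<comment> \<open>A regular class with the same set of factors makes \<open>x\<close> and
    \<open>e\<close> factors of each other.\<close>
  fix J assume J: "regular_J_class ?M J \<and> J \<subseteq> profinite_closure F \<and> profinite_closure F = factors_of ?M J"
  then obtain x where x: "x \<in> carrier ?M" "J = J_class_of ?M x" unfolding regular_J_class_def by blast
  have "x \<in> factors_of ?M {e}" using J P.J_class_of_self[OF x(1)] unfolding x(2) F by blast
  moreover have "e \<in> factors_of ?M {x}"
    using J P.factors_of_refl[OF e(1), of "{e}"] unfolding x(2) F P.factors_of_J_class[OF x(1)] by blast
  ultimately have "x \<in> J_class_of ?M e" using x(1) unfolding J_class_of_def by blast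
  then show "J = J_class_of ?M e" unfolding x(2) by (rule P.J_class_of_eq)
qed

text \<open>The projection to the coordinate of the syntactic congruence is continuous and has the
  right values on words; words being dense, no other continuous map does.\<close>

lemma syntactic_hom_ext_eq:
  assumes L: "syntactic_congruence L \<in> finite_congruences" and x: "x \<in> carrier profinite_monoid"
  shows "syntactic_hom_ext L x = x (syntactic_congruence L)"
proof -
  let ?\<theta> = "syntactic_congruence L"
  let ?T = "discrete_topology (carrier (syntactic_monoid L))"
  define f where "f = restrict (\<lambda>x. x ?\<theta>) (carrier profinite_monoid)"
  have "syntactic_hom_ext L = f" unfolding syntactic_hom_ext_def
  proof (rule the_equality)
    have "continuous_map profinite_topology ?T (\<lambda>x. x ?\<theta>)"
      unfolding profinite_topology_def syntactic_monoid_def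
      by (rule continuous_map_from_subtopology) (rule continuous_map_product_coordinates[OF L])
    then have "continuous_map profinite_topology ?T f"
      by (rule continuous_map_eq) (simp add: f_def topspace_profinite)
    then show "f \<in> extensional (carrier profinite_monoid) \<and> continuous_map profinite_topology ?T f \<and>
        (\<forall>w. f (of_word w) = syntactic_hom L w)"
      by (simp add: f_def of_word_in_profinite of_word_class[OF L] syntactic_hom_def)
  next
    fix g assume g: "g \<in> extensional (carrier profinite_monoid) \<and> continuous_map profinite_topology ?T g \<and>
        (\<forall>w. g (of_word w) = syntactic_hom L w)"
    show "g = f"
    proof (rule extensionalityI)
      show "g \<in> extensional (carrier profinite_monoid)" "f \<in> extensional (carrier profinite_monoid)"
        using g by (simp_all add: f_def)
      fix y :: "'a profinite" assume y: "y \<in> carrier profinite_monoid"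
      have "g y \<in> carrier (syntactic_monoid L)"
        using g y unfolding continuous_map_def topspace_profinite by auto
      then have "openin ?T {g y}" by simp
      then have "openin profinite_topology {z \<in> topspace profinite_topology. g z \<in> {g y}}"
        by (rule openin_continuous_map_preimage[rotated]) (use g in blast)
      from openin_profinite_nbhd[OF this, of y] obtain \<eta> where
        \<eta>: "\<eta> \<in> finite_congruences" "\<And>z. z \<in> carrier profinite_monoid \<Longrightarrow> z \<eta> = y \<eta> \<Longrightarrow> g z = g y"
        using y by (auto simp: topspace_profinite)
      \<comment> \<open>One word must approximate \<open>y\<close> both modulo
        \<open>\<eta>\<close>, where \<open>g\<close> is constant, and modulo the syntactic
        congruence; the intersection provides it.\<close>
      let ?\<zeta> = "\<eta> \<inter> ?\<theta>"
      have \<zeta>: "?\<zeta> \<in> finite_congruences" by (rule finite_congruences_Int[OF \<eta>(1) L])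
      obtain w where w: "w \<in> y ?\<zeta>" using profinite_nonempty[OF y \<zeta>] .
      have "w \<in> y \<eta>" "w \<in> y ?\<theta>"
        using profinite_coarsen[OF y \<zeta> \<eta>(1) _ w] profinite_coarsen[OF y \<zeta> L _ w] by auto
      then have "y \<eta> = \<eta> `` {w}" "y ?\<theta> = ?\<theta> `` {w}"
        using profinite_class_iff[OF y \<eta>(1)] profinite_class_iff[OF y L] by simp_all
      then have "g y = syntactic_hom L w" "f y = syntactic_hom L w"
        using \<eta>(2)[OF of_word_in_profinite, of w] g of_word_class[OF \<eta>(1), of w] y
        by (simp_all add: f_def syntactic_hom_def)
      then show "g y = f y" by simp
    qed
  qed
  then show ?thesis using x by (simp add: f_def)
qed

text \<open>A coordinate projection is a homomorphism and so preserves factors and idempotents; the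
  J-class containing the image is unique because it contains the image of \<open>e\<close>.\<close>

lemma J_of_code_eq:
  assumes L: "syntactic_congruence (star X) \<in> finite_congruences"
    and e: "e \<in> carrier profinite_monoid" "e \<otimes>\<^bsub>profinite_monoid\<^esub> e = e"
    and J: "J_of F = J_class_of profinite_monoid e"
  shows "J_of_code F X = J_class_of (syntactic_monoid (star X)) (e (syntactic_congruence (star X)))"
  unfolding J_of_code_def
proof (rule the_equality)
  interpret P: plain_monoid "profinite_monoid :: 'a profinite monoid" by (rule plain_monoid_profinite)
  let ?P = "profinite_monoid :: 'a profinite monoid"
  let ?\<theta> = "syntactic_congruence (star X)"
  let ?M = "syntactic_monoid (star X)"
  interpret M: plain_monoid ?M
    unfolding syntactic_monoid_def by (rule plain_monoid_quotient_monoid[OF list_congruence_syntactic])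
  have closed: "x ?\<theta> \<in> carrier ?M" if x: "x \<in> carrier ?P" for x
  proof -
    obtain w where "x ?\<theta> = ?\<theta> `` {w}" using profinite_cases[OF x L] .
    then show ?thesis unfolding syntactic_monoid_def by simp
  qed
  have mult: "(x \<otimes>\<^bsub>?P\<^esub> y) ?\<theta> = x ?\<theta> \<otimes>\<^bsub>?M\<^esub> y ?\<theta>" for x y :: "'a profinite"
    unfolding syntactic_monoid_def by (rule profinite_mult[OF L])
  have fac: "x ?\<theta> \<in> factors_of ?M {y ?\<theta>}" if "x \<in> factors_of ?P {y}" for x y
  proof -
    obtain u v where "x \<in> carrier ?P" "u \<in> carrier ?P" "v \<in> carrier ?P" "u \<otimes>\<^bsub>?P\<^esub> x \<otimes>\<^bsub>?P\<^esub> v \<in> {y}"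
      using \<open>x \<in> factors_of ?P {y}\<close> by (rule factors_ofE)
    then show ?thesis using mult by (intro factors_ofI[of _ _ "u ?\<theta>" "v ?\<theta>"]) (auto intro: closed)
  qed
  have img: "syntactic_hom_ext (star X) ` J_of F \<subseteq> J_class_of ?M (e ?\<theta>)"
  proof
    fix c assume "c \<in> syntactic_hom_ext (star X) ` J_of F"
    then obtain x where x: "x \<in> J_class_of ?P e" "c = syntactic_hom_ext (star X) x" unfolding J by blast
    then have "c = x ?\<theta>" "x \<in> carrier ?P" using syntactic_hom_ext_eq[OF L] unfolding J_class_of_def by auto
    then show "c \<in> J_class_of ?M (e ?\<theta>)" using x(1) fac closed unfolding J_class_of_def by blast
  qed
  have ee: "e ?\<theta> \<otimes>\<^bsub>?M\<^esub> e ?\<theta> = e ?\<theta>" using mult[of e e] e(2) by simp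
  show "regular_J_class ?M (J_class_of ?M (e ?\<theta>)) \<and>
      syntactic_hom_ext (star X) ` J_of F \<subseteq> J_class_of ?M (e ?\<theta>)"
    using regular_J_classI[OF closed[OF e(1)] ee M.J_class_of_self[OF closed[OF e(1)]]] img by blast
  fix K assume K: "regular_J_class ?M K \<and> syntactic_hom_ext (star X) ` J_of F \<subseteq> K"
  then obtain x where x: "K = J_class_of ?M x" unfolding regular_J_class_def by blast
  have "e \<in> J_of F" unfolding J by (rule P.J_class_of_self[OF e(1)])
  then have "e ?\<theta> \<in> K" using K syntactic_hom_ext_eq[OF L e(1)] by (metis imageI subsetD)
  then show "K = J_class_of ?M (e ?\<theta>)" unfolding x using M.J_class_of_eq by metis
qed


section \<open>Parses of words with respect to a group code\<close>

lemma star_Nil [simp]: "[] \<in> star X"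
  unfolding star_def by (rule image_eqI[of _ _ "[]"]) auto

lemma star_append: "x \<in> star X \<Longrightarrow> y \<in> star X \<Longrightarrow> x @ y \<in> star X"
  unfolding star_def
proof (elim imageE)
  fix xs ys assume "xs \<in> lists X" "ys \<in> lists X" "x = concat xs" "y = concat ys"
  then show "x @ y \<in> concat ` lists X" by (intro image_eqI[of _ _ "xs @ ys"]) auto
qed

lemma star_mono: "X \<subseteq> Y \<Longrightarrow> star X \<subseteq> star Y"
  unfolding star_def by (intro image_mono lists_mono)

lemma star_base: "x \<in> X \<Longrightarrow> x \<in> star X"
  unfolding star_def by (rule image_eqI[of _ _ "[x]"]) auto

lemma star_Int_factorial:
  assumes F: "factorial_set F" and "w \<in> star Z" "w \<in> F"
  shows "w \<in> star (Z \<inter> F)"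
proof -
  obtain xs where xs: "xs \<in> lists Z" "w = concat xs" using assms(2) unfolding star_def by blast
  have "x \<in> F" if x: "x \<in> set xs" for x
  proof -
    obtain ys zs where "xs = ys @ x # zs" using split_list[OF x] by blast
    then have "concat ys @ x @ concat zs \<in> F" using assms(3) xs(2) by simp
    then show ?thesis by (rule factorial_setD[OF F])
  qed
  then have "xs \<in> lists (Z \<inter> F)" using xs(1) by (auto simp: in_lists_conv_set)
  then show ?thesis unfolding star_def xs(2) by (rule imageI)
qed

lemma star_first_factor:
  assumes "w \<in> star X" "w \<noteq> []"
  shows "\<exists>p\<in>X. prefix p w"
proof -
  obtain xs where xs: "xs \<in> lists X" "w = concat xs" using assms(1) unfolding star_def by blast
  then obtain y ys where "xs = y # ys" using assms(2) by (cases xs) auto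
  then have "y \<in> X" "w = y @ concat ys" using xs by auto
  then show ?thesis by (auto intro: prefixI)
qed

lemma star_last_factor:
  assumes "w \<in> star X" "w \<noteq> []"
  shows "\<exists>s\<in>X. suffix s w"
proof -
  obtain xs where xs: "xs \<in> lists X" "w = concat xs" using assms(1) unfolding star_def by blast
  then obtain y ys where "xs = ys @ [y]" using assms(2) by (cases xs rule: rev_cases) auto
  then have "y \<in> X" "w = concat ys @ y" using xs by auto
  then show ?thesis by (auto simp: suffix_def)
qed

text \<open>A factorization of \<open>x\<close> over \<open>X\<close> followed by one of
  \<open>t\<close> over \<open>Z\<close> must coincide with the factorization of
  \<open>x @ t\<close> over \<open>X\<close>, so the part for \<open>t\<close> also uses words of
  \<open>X\<close> only.\<close>

lemma code_star_cancel:
  assumes "code Z" "X \<subseteq> Z" and x: "x \<in> star X" "x @ t \<in> star X" and t: "t \<in> star Z"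
  shows "t \<in> star X"
proof -
  obtain xs ys ts where 1: "xs \<in> lists X" "x = concat xs" "ys \<in> lists X" "x @ t = concat ys"
    "ts \<in> lists Z" "t = concat ts" using x t unfolding star_def by blast
  have "lists X \<subseteq> lists Z" using assms(2) by (rule lists_mono)
  then have "xs @ ts \<in> lists Z" "ys \<in> lists Z" using 1 by auto
  moreover have "concat (xs @ ts) = concat ys" using 1 by simp
  ultimately have "xs @ ts = ys" using assms(1) unfolding code_def by (meson inj_onD)
  then have "ts \<in> lists X" using 1(3) by auto
  then show ?thesis unfolding star_def 1(6) by (rule imageI)
qed

lemma star_prefix_split:
  assumes "p @ t \<in> star X"
  shows "\<exists>x s. p = x @ s \<and> x \<in> star X \<and> (s = [] \<or> (\<exists>z\<in>X. prefix s z))"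
proof -
  obtain xs where "xs \<in> lists X" "p @ t = concat xs" using assms unfolding star_def by force
  then show ?thesis
  proof (induction xs arbitrary: p rule: list.induct)
    case Nil
    then show ?case by auto
  next
    case (Cons y ys)
    have y: "y \<in> X" "ys \<in> lists X" using Cons.prems(1) by auto
    from Cons.prems(2) have "p @ t = y @ concat ys" by simp
    then obtain r where r: "p = y @ r \<and> r @ t = concat ys \<or> p @ r = y \<and> t = r @ concat ys"
      by (auto simp: append_eq_append_conv2)
    then show ?case
    proof
      assume r: "p = y @ r \<and> r @ t = concat ys"
      then obtain x s where "r = x @ s" "x \<in> star X" "s = [] \<or> (\<exists>z\<in>X. prefix s z)"
        using Cons.IH[OF y(2)] by blast
      then have "p = (y @ x) @ s" "y @ x \<in> star X" using r star_append[OF star_base[OF y(1)]] by auto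
      then show ?thesis using \<open>s = [] \<or> (\<exists>z\<in>X. prefix s z)\<close> by blast
    next
      assume "p @ r = y \<and> t = r @ concat ys"
      then have "prefix p y" by auto
      then show ?thesis using y(1) by (intro exI[of _ "[]"] exI[of _ p]) auto
    qed
  qed
qed

text \<open>The parse \<open>(v, x, u)\<close> corresponds to the state reached by \<open>u\<close>.
  Two suffixes with the same state differ by a word of \<open>star Z\<close> inside
  \<open>w\<close>, which cannot begin with a word of the code; \<open>v\<close> is unique by the
  symmetric argument. Conversely, given a state, take the shortest \<open>u\<close> and then the
  shortest \<open>v\<close>. As \<open>F\<close> is any factorial set, the case of all words is
  covered too.\<close>

lemma (in perm_automaton) card_parses:
  assumes nonempty: "[] \<notin> Z" and Z: "star Z = recognized i \<delta>"
    and F: "factorial_set F" and w: "w \<in> F"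
  shows "card (parses (Z \<inter> F) w) = card (states w)"
proof -
  let ?X = "Z \<inter> F"
  have star_run: "run \<delta> i y = i" if "y \<in> star ?X" for y
    using that star_mono[of ?X Z] Z unfolding recognized_def by blast
  have in_star: "y \<in> star ?X" if "y \<in> F" "run \<delta> i y = i" for y
    using that star_Int_factorial[OF F _ that(1)] Z unfolding recognized_def by blast
  have right: "u = u'"
    if "w = a @ u" "w = a' @ u'" "run \<delta> i u = run \<delta> i u'" "length u' \<le> length u"
      "\<not> (\<exists>p\<in>?X. prefix p u)" for a a' u u'
  proof -
    have "suffix u' w" "suffix u w" using that(1,2) suffix_def by blast+
    then have "suffix u' u" using that(4) by (rule suffix_length_suffix)
    then obtain y where y: "u = y @ u'" unfolding suffix_def by blast
    have "y \<in> F" using factorial_setD[OF F, of a y u'] w that(1) y by simp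
    moreover have "run \<delta> i y = i" using that(3) y by simp
    ultimately have "y \<in> star ?X" by (rule in_star)
    have "y = []"
    proof (rule ccontr)
      assume "y \<noteq> []"
      then obtain p where "p \<in> ?X" "prefix p y" using star_first_factor[OF \<open>y \<in> star ?X\<close>] by blast
      then show False using that(5) y by (meson prefix_order.trans prefixI)
    qed
    then show ?thesis using y by simp
  qed
  have left: "v = v'"
    if "w = v @ x @ u" "v @ x = v' @ x'" "x \<in> star ?X" "x' \<in> star ?X" "length v \<le> length v'"
      "\<not> (\<exists>s\<in>?X. suffix s v')" for u v v' x x'
  proof -
    have "prefix v (v @ x)" by simp
    moreover have "prefix v' (v @ x)" unfolding that(2) by simp
    ultimately have "prefix v v'" using that(5) by (rule prefix_length_prefix)
    then obtain y where y: "v' = v @ y" unfolding prefix_def by blast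
    then have x: "x = y @ x'" using that(2) by simp
    have "y \<in> F" using factorial_setD[OF F, of v y "x' @ u"] w that(1) x by simp
    moreover have "run \<delta> (run \<delta> i y) x' = run \<delta> i x'" using star_run[OF that(3)] star_run[OF that(4)] x by simp
    then have "run \<delta> i y = i" by simp
    ultimately have "y \<in> star ?X" by (rule in_star)
    have "y = []"
    proof (rule ccontr)
      assume "y \<noteq> []"
      then obtain p where "p \<in> ?X" "suffix p y" using star_last_factor[OF \<open>y \<in> star ?X\<close>] by blast
      then show False using that(6) y by (meson suffix_appendI)
    qed
    then show ?thesis using y by simp
  qed
  have "bij_betw (\<lambda>(v, x, u). run \<delta> i u) (parses ?X w) (states w)"
    unfolding bij_betw_def
  proof
    show "inj_on (\<lambda>(v, x, u). run \<delta> i u) (parses ?X w)"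
    proof (rule inj_onI)
      fix a b
      assume ab: "a \<in> parses ?X w" "b \<in> parses ?X w"
        "(\<lambda>(v, x, u). run \<delta> i u) a = (\<lambda>(v, x, u). run \<delta> i u) b"
      obtain v x u v' x' u' where a: "a = (v, x, u)" and b: "b = (v', x', u')" by (metis prod_cases3)
      have r: "run \<delta> i u = run \<delta> i u'" using ab(3) unfolding a b by simp
      from ab(1,2) have 1: "w = v @ x @ u" "\<not> (\<exists>s\<in>?X. suffix s v)" "x \<in> star ?X" "\<not> (\<exists>p\<in>?X. prefix p u)"
        and 2: "w = v' @ x' @ u'" "\<not> (\<exists>s\<in>?X. suffix s v')" "x' \<in> star ?X" "\<not> (\<exists>p\<in>?X. prefix p u')"
        unfolding parses_def a b by auto
      have u: "u = u'"
      proof (cases "length u' \<le> length u")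
        case True
        then show ?thesis using right[of "v @ x" u "v' @ x'" u'] 1 2 r by simp
      next
        case False
        then show ?thesis using right[of "v' @ x'" u' "v @ x" u] 1 2 r by simp
      qed
      then have vx: "v @ x = v' @ x'" using 1(1) 2(1) by simp
      have "v = v'"
      proof (cases "length v \<le> length v'")
        case True
        then show ?thesis using left[OF 1(1) vx 1(3) 2(3) _ 2(2)] by simp
      next
        case False
        then show ?thesis using left[OF 2(1) vx[symmetric] 2(3) 1(3) _ 1(2)] by simp
      qed
      then show "a = b" using u vx unfolding a b by simp
    qed
    show "(\<lambda>(v, x, u). run \<delta> i u) ` parses ?X w = states w"
    proof
      show "(\<lambda>(v, x, u). run \<delta> i u) ` parses ?X w \<subseteq> states w"
        unfolding parses_def states_def by (auto simp: suffix_def)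
      show "states w \<subseteq> (\<lambda>(v, x, u). run \<delta> i u) ` parses ?X w"
      proof
        fix q assume "q \<in> states w"
        then obtain s where s: "suffix s w" "q = run \<delta> i s" unfolding states_def by blast
        then have "suffix s w \<and> run \<delta> i s = q" by simp
        from ex_has_least_nat[of "\<lambda>u. suffix u w \<and> run \<delta> i u = q", OF this, of length]
        obtain u where u: "suffix u w" "run \<delta> i u = q"
          "\<And>u'. suffix u' w \<Longrightarrow> run \<delta> i u' = q \<Longrightarrow> length u \<le> length u'" by blast
        obtain w' where w': "w = w' @ u" using u(1) unfolding suffix_def by blast
        have "\<exists>x. w' = w' @ x \<and> x \<in> star ?X" by (rule exI[of _ "[]"]) simp
        from ex_has_least_nat[of "\<lambda>v. \<exists>x. w' = v @ x \<and> x \<in> star ?X", OF this, of length]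
        obtain v x where v: "w' = v @ x" "x \<in> star ?X"
          "\<And>v' x'. w' = v' @ x' \<Longrightarrow> x' \<in> star ?X \<Longrightarrow> length v \<le> length v'" by blast
        have np: "\<not> (\<exists>p\<in>?X. prefix p u)"
        proof
          assume "\<exists>p\<in>?X. prefix p u"
          then obtain p u' where p: "p \<in> ?X" "u = p @ u'" unfolding prefix_def by blast
          then have "run \<delta> i u' = q" using star_run[OF star_base] u(2) by simp
          moreover have "suffix u' w" using p w' by (simp add: suffix_def)
          ultimately have "p = []" using u(3)[of u'] p(2) by simp
          with p(1) nonempty show False by blast
        qed
        have ns: "\<not> (\<exists>s\<in>?X. suffix s v)"
        proof
          assume "\<exists>s\<in>?X. suffix s v"
          then obtain s v' where s: "s \<in> ?X" "v = v' @ s" unfolding suffix_def by blast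
          then have "s = []" using v(3)[of v' "s @ x"] v(1,2) star_append[OF star_base[OF s(1)]] by simp
          with s(1) nonempty show False by blast
        qed
        have "(v, x, u) \<in> parses ?X w" unfolding parses_def using w' v np ns by simp
        then show "q \<in> (\<lambda>(v, x, u). run \<delta> i u) ` parses ?X w" using u(2) by force
      qed
    qed
  qed
  then show ?thesis by (rule bij_betw_same_card)
qed


section \<open>The code \<open>Z \<inter> F\<close>\<close>

locale code_in_connected_set = perm_automaton Q i \<delta>
  for Q :: "'q set" and i :: 'q and \<delta> :: "'a::finite \<Rightarrow> 'q \<Rightarrow> 'q" +
  fixes Z F X :: "'a list set"
  assumes code: "code Z" and star_Z: "star Z = recognized i \<delta>"
    and F: "uniformly_recurrent F" "connected_set F" "alphabet F = UNIV"
    and X_def: "X = Z \<inter> F"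
begin

lemma rec: "recurrent F" and fac: "factorial_set F"
  using F unfolding connected_set_def recurrent_def by auto

lemma X_subset: "X \<subseteq> Z" "X \<subseteq> F"
  unfolding X_def by auto

lemma in_star_Z: "y \<in> star Z \<longleftrightarrow> run \<delta> i y = i"
  unfolding star_Z recognized_def by simp

lemma star_run: "y \<in> star X \<Longrightarrow> run \<delta> i y = i"
  using star_mono[OF X_subset(1)] in_star_Z by blast

lemma in_star: "y \<in> F \<Longrightarrow> run \<delta> i y = i \<Longrightarrow> y \<in> star X"
  unfolding X_def by (rule star_Int_factorial[OF fac]) (simp_all add: in_star_Z)

text \<open>The states of the minimal automaton of \<open>star X\<close> are the residuals.\<close>

definition res :: "'a list \<Rightarrow> 'a list set" where
  "res p = {t. p @ t \<in> star X}"

lemma res_append: "res (p @ u) = {t. u @ t \<in> res p}"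
  unfolding res_def by simp

lemma res_append_cong: "res p = res q \<Longrightarrow> res (p @ u) = res (q @ u)"
  unfolding res_append by simp

lemma res_append_empty: "res p = {} \<Longrightarrow> res (p @ u) = {}"
  unfolding res_append by simp

text \<open>A common completion leads both states to \<open>i\<close>, and words act injectively on
  \<open>Q\<close>.\<close>

lemma res_run: "res p = res q \<Longrightarrow> res p \<noteq> {} \<Longrightarrow> run \<delta> i p = run \<delta> i q"
proof -
  assume "res p = res q" "res p \<noteq> {}"
  then obtain t where "p @ t \<in> star X" "q @ t \<in> star X" unfolding res_def by blast
  then have "run \<delta> (run \<delta> i p) t = run \<delta> (run \<delta> i q) t"
    using star_run[of "p @ t"] star_run[of "q @ t"] by simp
  then show ?thesis by simp
qed

text \<open>After \<open>x\<close> the group automaton is back in \<open>i\<close>, so the rest of a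
  word of \<open>star X\<close> lies in \<open>star Z\<close>; unique factorization puts it in
  \<open>star X\<close>.\<close>

lemma res_star: "x \<in> star X \<Longrightarrow> res (x @ s) = res s"
proof -
  assume x: "x \<in> star X"
  have "s @ t \<in> star X" if t: "x @ (s @ t) \<in> star X" for t
  proof (rule code_star_cancel[OF code X_subset(1) x t])
    have "run \<delta> (run \<delta> i x) (s @ t) = i" using star_run[OF t] by simp
    then show "s @ t \<in> star Z" unfolding in_star_Z star_run[OF x] .
  qed
  then show ?thesis using star_append[OF x] unfolding res_def by auto
qed

lemma res_split:
  assumes "res p \<noteq> {}"
  shows "\<exists>x s. p = x @ s \<and> x \<in> star X \<and> (s = [] \<or> (\<exists>z\<in>X. prefix s z))"
proof -
  obtain t where "p @ t \<in> star X" using assms unfolding res_def by blast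
  then show ?thesis by (rule star_prefix_split)
qed

text \<open>The state reached from \<open>q\<close> by \<open>w\<close> is also reached from
  \<open>i\<close> by some suffix of \<open>w\<close>; cancelling this suffix shows that the path
  from \<open>q\<close> has just passed through \<open>i\<close>.\<close>

lemma run_back:
  assumes w: "states w = Q" and q: "q \<in> Q"
  obtains v where "prefix v w" "run \<delta> q v = i"
proof -
  have "run \<delta> q w \<in> states w" using w q by simp
  then obtain s v where s: "w = v @ s" "run \<delta> q w = run \<delta> i s"
    unfolding states_def suffix_def by blast
  then have "run \<delta> (run \<delta> q v) s = run \<delta> i s" by simp
  then have "run \<delta> q v = i" using q by simp
  moreover have "prefix v w" unfolding s(1) by simp
  ultimately show thesis by (intro that)
qed

text \<open>A long word of \<open>X\<close> contains a full word in its interior, where its path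
  from \<open>i\<close> returns to \<open>i\<close>. It would thus split into two nonempty words of
  \<open>star X\<close>, which is impossible in a code.\<close>

lemma bounded_length: "\<exists>N. \<forall>x\<in>X. length x \<le> N"
proof -
  obtain w where w: "w \<in> F" "states w = Q" using full_word[OF F] by blast
  obtain n where n: "\<And>x. x \<in> F \<Longrightarrow> length x \<ge> n \<Longrightarrow> sublist w x"
    using F(1) w(1) unfolding uniformly_recurrent_def by blast
  \<comment> \<open>Length at least \<open>n + 2\<close> leaves a factor of length \<open>n\<close>
    after removing the first and last letters; these letters keep both parts nonempty.\<close>
  have "length x \<le> Suc n" if x: "x \<in> X" for x
  proof (rule ccontr)
    assume len: "\<not> length x \<le> Suc n"
    then obtain a y c where x_eq: "x = [a] @ y @ [c]"
    proof -
      obtain a x' where "x = a # x'" using len by (cases x) auto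
      moreover then obtain y c where "x' = y @ [c]" using len by (cases x' rule: rev_cases) auto
      ultimately show thesis using that by simp
    qed
    have "y \<in> F" using factorial_setD[OF fac] x X_subset(2) unfolding x_eq by blast
    then have "sublist w y" using n len x_eq by simp
    then obtain y1 y2 where y: "y = y1 @ w @ y2" unfolding sublist_def by blast
    obtain v where v: "prefix v w" "run \<delta> (run \<delta> i ([a] @ y1)) v = i"
      by (rule run_back[OF w(2), of "run \<delta> i ([a] @ y1)"]) simp
    then obtain w' where w': "w = v @ w'" unfolding prefix_def by blast
    define p t where "p = [a] @ y1 @ v" and "t = w' @ y2 @ [c]"
    have x_pt: "x = p @ t" unfolding x_eq y w' p_def t_def by simp
    have "p \<in> F" using factorial_set_prefixD[OF fac, of p t] x X_subset(2) x_pt by blast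
    moreover have "run \<delta> i p = i" using v(2) unfolding p_def by (simp only: run_append)
    ultimately have p: "p \<in> star X" by (rule in_star)
    have "t \<in> star X" using res_star[OF p, of "[]"] star_base[OF x] unfolding x_pt res_def by auto
    then obtain ps ts where "ps \<in> lists X" "p = concat ps" "ts \<in> lists X" "t = concat ts"
      using p unfolding star_def by blast
    then have *: "ps @ ts \<in> lists Z" "[x] \<in> lists Z" "concat (ps @ ts) = concat [x]" "ps \<noteq> []" "ts \<noteq> []"
      using X_subset(1) x x_pt by (auto simp: p_def t_def)
    then have "ps @ ts = [x]" using code unfolding code_def by (meson inj_onD)
    then show False using *(4,5) by (simp add: append_eq_Cons_conv)
  qed
  then show ?thesis by blast
qed

text \<open>Continue \<open>f\<close> inside \<open>F\<close> by a full word: on the way the path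
  passes through \<open>i\<close>, and the word read so far is in \<open>F\<close>.\<close>

lemma res_nonempty:
  assumes f: "f \<in> F"
  shows "res f \<noteq> {}"
proof -
  obtain w where w: "w \<in> F" "states w = Q" using full_word[OF F] by blast
  obtain g where g: "f @ g @ w \<in> F" using rec f w(1) unfolding recurrent_def by blast
  obtain v where v: "prefix v w" "run \<delta> (run \<delta> i (f @ g)) v = i"
    by (rule run_back[OF w(2), of "run \<delta> i (f @ g)"]) simp
  then obtain w' where w': "w = v @ w'" unfolding prefix_def by blast
  have "f @ g @ v \<in> F" using factorial_set_prefixD[OF fac, of "f @ g @ v" w'] g w' by simp
  then have "f @ g @ v \<in> star X" using v(2) by (intro in_star) simp_all
  then show ?thesis unfolding res_def by auto
qed

text \<open>The suffixes of a full word reach every state, and the word \<open>g\<close> linking it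
  to \<open>w\<close> merely permutes \<open>Q\<close>.\<close>

lemma run_before:
  assumes w: "w \<in> F" and q: "q \<in> Q"
  obtains f where "f @ w \<in> F" "run \<delta> i f = q"
proof -
  obtain v where v: "v \<in> F" "states v = Q" using full_word[OF F] by blast
  obtain g where g: "v @ g @ w \<in> F" using rec v(1) w unfolding recurrent_def by blast
  obtain p where p: "p \<in> Q" "run \<delta> p g = q" by (rule run_surj[OF q])
  then obtain s v' where s: "v = v' @ s" "p = run \<delta> i s" using v(2) unfolding states_def suffix_def by blast
  have "(s @ g) @ w \<in> F" using factorial_set_suffixD[OF fac, of v' "s @ g @ w"] g s by simp
  then show thesis using that[of "s @ g"] p s by simp
qed

lemma F_degree_eq: "F_degree F X = enat (card Q)"
  and code_degree_eq: "code_degree Z = enat (card Q)"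
proof -
  obtain w where w: "w \<in> F" "states w = Q" using full_word[OF F] by blast
  have ne: "[] \<notin> Z" using code unfolding code_def by blast
  \<comment> \<open>Stated for a general \<open>E\<close>, since the two degrees are the cases of
    \<open>F\<close> and of the set of all words.\<close>
  have *: "F_degree E (Z \<inter> E) = enat (card Q)" if E: "factorial_set E" "w \<in> E" for E
  proof -
    have "F_degree E (Z \<inter> E) = (SUP v\<in>E. enat (card (states v)))"
      unfolding F_degree_def by (rule SUP_cong) (simp_all add: card_parses[OF ne star_Z E(1)])
    also have "\<dots> = enat (card Q)"
    proof (rule antisym)
      show "(SUP v\<in>E. enat (card (states v))) \<le> enat (card Q)"
        by (rule SUP_least) (simp add: card_mono[OF fin_Q states_subset])
      show "enat (card Q) \<le> (SUP v\<in>E. enat (card (states v)))"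
        using SUP_upper[OF E(2), of "\<lambda>v. enat (card (states v))"] w(2) by simp
    qed
    finally show ?thesis .
  qed
  show "F_degree F X = enat (card Q)" using *[OF fac w(1)] unfolding X_def .
  show "code_degree Z = enat (card Q)" using *[of UNIV] unfolding code_degree_def by (simp add: factorial_set_def)
qed

section \<open>The syntactic congruences of \<open>star X\<close> and \<open>star Z\<close>, and the
  group of \<open>Z\<close>\<close>

abbreviation "\<theta>X \<equiv> syntactic_congruence (star X)"
abbreviation "\<theta>Z \<equiv> syntactic_congruence (star Z)"

lemmas congX = list_congruence_syntactic[of "star X"]
lemmas congZ = list_congruence_syntactic[of "star Z"]

lemma in_\<theta>X: "(u, v) \<in> \<theta>X \<longleftrightarrow> (\<forall>p. res (p @ u) = res (p @ v))"
  unfolding syntactic_congruence_def res_def by (auto simp: set_eq_iff)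

text \<open>A nonempty residual is that of a prefix of a code word (or of the empty word), so there
  are finitely many; the invariant of \<open>u\<close> is the graph of its action on them.\<close>

lemma \<theta>X_finite: "\<theta>X \<in> finite_congruences"
proof (rule finite_congruencesI[OF congX, where f = "\<lambda>u. range (\<lambda>p. (res p, res (p @ u)))"])
  obtain N where N: "\<And>x. x \<in> X \<Longrightarrow> length x \<le> N" using bounded_length by blast
  have "range res \<subseteq> insert {} (res ` {s. set s \<subseteq> UNIV \<and> length s \<le> N})"
  proof
    fix R assume "R \<in> range res"
    then obtain p where R: "R = res p" by blast
    show "R \<in> insert {} (res ` {s. set s \<subseteq> UNIV \<and> length s \<le> N})"
    proof (cases "res p = {}")
      case False
      then obtain x s where x: "p = x @ s" "x \<in> star X" "s = [] \<or> (\<exists>z\<in>X. prefix s z)"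
        using res_split by blast
      then have "length s \<le> N" using N prefix_length_le by fastforce
      moreover have "R = res s" unfolding R x(1) by (rule res_star[OF x(2)])
      ultimately show ?thesis by blast
    qed (simp add: R)
  qed
  moreover have "finite {s :: 'a list. set s \<subseteq> UNIV \<and> length s \<le> N}"
    by (rule finite_lists_length_le) simp
  ultimately have "finite (range res)" by (meson finite_imageI finite_insert finite_subset)
  then have "finite (Pow (range res \<times> range res))" by simp
  then show "finite (range (\<lambda>u. range (\<lambda>p. (res p, res (p @ u)))))"
    by (rule finite_subset[rotated]) auto
next
  fix u v assume eq: "range (\<lambda>p. (res p, res (p @ u))) = range (\<lambda>p. (res p, res (p @ v)))"
  show "(u, v) \<in> \<theta>X" unfolding in_\<theta>X
  proof
    fix p
    have "(res p, res (p @ u)) \<in> range (\<lambda>p. (res p, res (p @ v)))" unfolding eq[symmetric] by (rule rangeI)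
    then obtain p' where "res p = res p'" "res (p @ u) = res (p' @ v)" by auto
    then show "res (p @ u) = res (p @ v)" using res_append_cong[of p p' v] by simp
  qed
qed

text \<open>By trimness each state is reached by some \<open>x\<close> and leads back to
  \<open>i\<close> by some \<open>y\<close>; such contexts separate states because words act
  injectively.\<close>

lemma in_\<theta>Z: "(u, v) \<in> \<theta>Z \<longleftrightarrow> (\<forall>q\<in>Q. run \<delta> q u = run \<delta> q v)"
proof
  assume uv: "(u, v) \<in> \<theta>Z"
  show "\<forall>q\<in>Q. run \<delta> q u = run \<delta> q v"
  proof
    fix q assume q: "q \<in> Q"
    obtain x where x: "run \<delta> i x = q" using reach[OF q] by blast
    have "run \<delta> q u \<in> Q" using q by simp
    then obtain y where y: "run \<delta> (run \<delta> q u) y = i" using aut unfolding group_automaton_def by blast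
    have "x @ u @ y \<in> star Z" using x y by (simp add: in_star_Z)
    then have "x @ v @ y \<in> star Z" using uv unfolding syntactic_congruence_def by blast
    then have "run \<delta> (run \<delta> q v) y = run \<delta> (run \<delta> q u) y" using x y by (simp add: in_star_Z)
    then show "run \<delta> q u = run \<delta> q v" using q by simp
  qed
qed (simp add: syntactic_congruence_def in_star_Z)

lemma finite_transitions: "finite (range (\<lambda>u. restrict (\<lambda>q. run \<delta> q u) Q))"
proof (rule finite_subset)
  show "range (\<lambda>u. restrict (\<lambda>q. run \<delta> q u) Q) \<subseteq> Q \<rightarrow>\<^sub>E Q" by auto
  show "finite (Q \<rightarrow>\<^sub>E Q)" by (rule finite_PiE) (simp_all add: fin_Q)
qed

lemma \<theta>Z_finite: "\<theta>Z \<in> finite_congruences"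
proof (rule finite_congruencesI[OF congZ finite_transitions])
  fix u v :: "'a list" assume "restrict (\<lambda>q. run \<delta> q u) Q = restrict (\<lambda>q. run \<delta> q v) Q"
  then have "run \<delta> q u = run \<delta> q v" if "q \<in> Q" for q using that by (metis restrict_apply')
  then show "(u, v) \<in> \<theta>Z" unfolding in_\<theta>Z by blast
qed

text \<open>Two powers with exponents \<open>a < b\<close> act alike on \<open>Q\<close>; cancelling
  the smaller one leaves \<open>m = b - a - 1\<close>.\<close>

lemma run_power:
  "\<exists>m. \<forall>q\<in>Q. run \<delta> q (concat (replicate (Suc m) u)) = q"
proof -
  let ?f = "\<lambda>n. restrict (\<lambda>q. run \<delta> q (concat (replicate n u))) Q"
  have "finite (range ?f)" by (rule finite_subset[OF _ finite_transitions]) auto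
  then have "\<not> inj ?f" using finite_imageD infinite_UNIV_nat by blast
  then obtain a b where ab: "a < b" "?f a = ?f b" unfolding inj_def by (metis linorder_neqE_nat)
  obtain m where m: "b = Suc m + a" using ab(1) by (metis add.commute add_Suc_right less_iff_Suc_add)
  have "run \<delta> q (concat (replicate (Suc m) u)) = q" if q: "q \<in> Q" for q
  proof -
    have "run \<delta> q (concat (replicate a u)) = run \<delta> q (concat (replicate b u))"
      using fun_cong[OF ab(2), of q] q by simp
    also have "concat (replicate b u) = concat (replicate (Suc m) u) @ concat (replicate a u)"
      unfolding m replicate_add by simp
    finally have "run \<delta> (run \<delta> q (concat (replicate (Suc m) u))) (concat (replicate a u)) =
        run \<delta> q (concat (replicate a u))" by simp
    then show ?thesis using q by (subst (asm) run_eq_iff) simp_all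
  qed
  then show ?thesis by blast
qed

lemma concat_replicate_Suc: "concat (replicate (Suc m) u) = concat (replicate m u) @ u"
  by (induction m) auto

definition GZ :: "'a list set monoid" where
  "GZ = syntactic_monoid (star Z)"

lemma GZ_mult: "\<theta>Z `` {u} \<otimes>\<^bsub>GZ\<^esub> \<theta>Z `` {v} = \<theta>Z `` {u @ v}"
  and GZ_one: "\<one>\<^bsub>GZ\<^esub> = \<theta>Z `` {[]}"
  and GZ_carrier: "carrier GZ = range (\<lambda>w. \<theta>Z `` {w})"
  and GZ_monoid: "plain_monoid GZ"
  unfolding GZ_def syntactic_monoid_def
  by (simp_all add: mult_quotient_monoid[OF congZ] one_quotient_monoid carrier_quotient_monoid
      plain_monoid_quotient_monoid[OF congZ])

lemma GZ_finite: "finite (carrier GZ)"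
  unfolding GZ_carrier by (rule finite_congruencesD(2)[OF \<theta>Z_finite])

lemma GZ_class_eq: "\<theta>Z `` {u} = \<theta>Z `` {v} \<longleftrightarrow> (\<forall>q\<in>Q. run \<delta> q u = run \<delta> q v)"
  by (simp add: congruence_class_eq_iff[OF congZ] in_\<theta>Z)

lemma group_GZ: "group GZ"
proof -
  interpret plain_monoid GZ by (rule GZ_monoid)
  show ?thesis
  proof (rule groupI)
    fix x assume "x \<in> carrier GZ"
    then obtain u where u: "x = \<theta>Z `` {u}" unfolding GZ_carrier by blast
    obtain m where "\<forall>q\<in>Q. run \<delta> q (concat (replicate (Suc m) u)) = q" using run_power by blast
    then have "\<theta>Z `` {concat (replicate m u) @ u} = \<theta>Z `` {[]}"
      unfolding concat_replicate_Suc[symmetric] GZ_class_eq by simp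
    then have "\<theta>Z `` {concat (replicate m u)} \<otimes>\<^bsub>GZ\<^esub> x = \<one>\<^bsub>GZ\<^esub>" unfolding u GZ_mult GZ_one .
    then show "\<exists>y\<in>carrier GZ. y \<otimes>\<^bsub>GZ\<^esub> x = \<one>\<^bsub>GZ\<^esub>" unfolding GZ_carrier by blast
  qed (simp_all add: m_assoc)
qed

text \<open>\<open>GZ\<close> is a group, so an ideal containing \<open>x\<close> contains the
  identity and hence everything: the minimum ideal is the whole monoid, and its maximal subgroup is
  \<open>GZ\<close> itself.\<close>

lemma group_of_code_iso: "GZ \<cong> group_of_code Z"
proof -
  interpret plain_monoid GZ by (rule GZ_monoid)
  interpret group GZ by (rule group_GZ)
  have one_mem: "\<one>\<^bsub>GZ\<^esub> \<otimes>\<^bsub>GZ\<^esub> \<one>\<^bsub>GZ\<^esub> = \<one>\<^bsub>GZ\<^esub>" by simp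
  have lu: "local_units GZ \<one>\<^bsub>GZ\<^esub> = carrier GZ"
  proof -
    have "\<exists>k\<in>carrier GZ. \<one>\<^bsub>GZ\<^esub> \<otimes>\<^bsub>GZ\<^esub> k = k \<and> k \<otimes>\<^bsub>GZ\<^esub> \<one>\<^bsub>GZ\<^esub> = k \<and>
        x \<otimes>\<^bsub>GZ\<^esub> k = \<one>\<^bsub>GZ\<^esub> \<and> k \<otimes>\<^bsub>GZ\<^esub> x = \<one>\<^bsub>GZ\<^esub>"
      if "x \<in> carrier GZ" for x
      using that by (intro bexI[of _ "inv\<^bsub>GZ\<^esub> x"]) simp_all
    then show ?thesis unfolding local_units_def by auto
  qed
  have J: "J_class_of GZ \<one>\<^bsub>GZ\<^esub> = carrier GZ"
    using local_units_subset_J_class[OF one_closed one_mem] unfolding lu by (auto simp: J_class_of_def)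
  have "minimum_ideal GZ = carrier GZ" unfolding minimum_ideal_def
  proof (rule Least_equality)
    show "monoid_ideal GZ (carrier GZ)" unfolding monoid_ideal_def by auto
    fix I assume I: "monoid_ideal GZ I"
    then obtain x where x: "x \<in> I" "x \<in> carrier GZ" unfolding monoid_ideal_def by blast
    then have "x \<otimes>\<^bsub>GZ\<^esub> inv\<^bsub>GZ\<^esub> x \<in> I" using I inv_closed unfolding monoid_ideal_def by blast
    then have "\<one>\<^bsub>GZ\<^esub> \<in> I" using x(2) by simp
    then have "\<one>\<^bsub>GZ\<^esub> \<otimes>\<^bsub>GZ\<^esub> y \<in> I" if "y \<in> carrier GZ" for y using I that unfolding monoid_ideal_def by blast
    then show "carrier GZ \<le> I" by auto
  qed
  then have eq: "group_of_code Z = schutzenberger_group GZ (J_class_of GZ \<one>\<^bsub>GZ\<^esub>)"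
    unfolding group_of_code_def J by (simp add: GZ_def)
  have "group_of_code Z \<cong> group_at GZ \<one>\<^bsub>GZ\<^esub>"
    unfolding eq by (rule schutzenberger_group_iso[OF GZ_monoid GZ_finite one_closed one_mem])
  moreover have "group_at GZ \<one>\<^bsub>GZ\<^esub> = GZ" unfolding group_at_def lu by simp
  moreover have "group (group_of_code Z)"
    unfolding eq by (rule group_schutzenberger_group[OF GZ_monoid one_closed one_mem])
  ultimately show ?thesis using group.iso_sym by metis
qed

end


section \<open>The maximal subgroup at \<open>w0\<close> and its embedding into
  \<open>GZ\<close>\<close>

locale idempotent_in_connected_set = code_in_connected_set Q i \<delta> Z F X
  for Q :: "'q set" and i :: 'q and \<delta> :: "'a::finite \<Rightarrow> 'q \<Rightarrow> 'q" and Z F X :: "'a list set" +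
  fixes w0 :: "'a list"
  assumes w0_in: "w0 \<in> F" and w0_idem: "(w0 @ w0, w0) \<in> \<theta>X"
    and w0_long: "\<And>x. x \<in> X \<Longrightarrow> length x \<le> length w0"
begin

text \<open>The remainder \<open>s\<close> is a prefix of a code word, so by the choice of the
  length of \<open>w0\<close> it lies within \<open>w0\<close>.\<close>

lemma res_w0_split:
  assumes "res (p @ w0) \<noteq> {}"
  obtains x s where "p @ w0 = x @ s" "x \<in> star X" "suffix s w0" "s \<in> F"
proof -
  obtain x s where x: "p @ w0 = x @ s" "x \<in> star X" "s = [] \<or> (\<exists>z\<in>X. prefix s z)"
    using res_split[OF assms] by blast
  have len: "length s \<le> length w0"
    using x(3) w0_long prefix_length_le order_trans by fastforce
  have "suffix s (p @ w0)" unfolding x(1) suffix_def by blast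
  moreover have "suffix w0 (p @ w0)" by (simp add: suffix_def)
  ultimately have s: "suffix s w0" using len by (rule suffix_length_suffix)
  then obtain v where "w0 = v @ s" unfolding suffix_def by blast
  then have "s \<in> F" using factorial_set_suffixD[OF fac, of v s] w0_in by simp
  with x(1,2) s show thesis by (rule that)
qed

text \<open>Only the state reached in the group automaton of \<open>Z\<close> matters after reading \<open>w0\<close>: two
  suffixes of \<open>w0\<close> leading to the same state differ by a factor of \<open>w0\<close> lying in \<open>star X\<close>.\<close>

lemma res_w0_eq:
  assumes p: "res (p @ w0) \<noteq> {}" and q: "res (q @ w0) \<noteq> {}"
    and run: "run \<delta> i (p @ w0) = run \<delta> i (q @ w0)"
  shows "res (p @ w0) = res (q @ w0)"
proof -
  have *: "res s' = res s"
    if s: "suffix s w0" "suffix s' w0" "run \<delta> i s = run \<delta> i s'" "length s \<le> length s'" for s s'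
  proof -
    have "suffix s s'" using s(1,2,4) by (rule suffix_length_suffix)
    then obtain v where v: "s' = v @ s" unfolding suffix_def by blast
    obtain v' where v': "w0 = v' @ s'" using s(2) unfolding suffix_def by blast
    have "v \<in> F" using factorial_setD[OF fac, of v' v s] w0_in unfolding v' v by simp
    moreover have "run \<delta> i v = i" using s(3) unfolding v by simp
    ultimately have "v \<in> star X" by (rule in_star)
    then show ?thesis unfolding v by (rule res_star)
  qed
  obtain x s where x: "p @ w0 = x @ s" "x \<in> star X" "suffix s w0" by (rule res_w0_split[OF p])
  obtain y t where y: "q @ w0 = y @ t" "y \<in> star X" "suffix t w0" by (rule res_w0_split[OF q])
  have "run \<delta> i s = run \<delta> i t"
    using run star_run[OF x(2)] star_run[OF y(2)] unfolding x(1) y(1) by simp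
  then have "res s = res t" using *[of s t] *[of t s] x(3) y(3) by (cases "length s \<le> length t") auto
  then show ?thesis unfolding x(1) y(1) by (simp add: res_star[OF x(2)] res_star[OF y(2)])
qed

text \<open>The word \<open>p @ w0\<close> has the residual of a suffix \<open>s\<close> of
  \<open>w0\<close>, and \<open>s @ r\<close>, being in \<open>F\<close>, can be completed.\<close>

lemma res_w0_append:
  assumes p: "res (p @ w0) \<noteq> {}" and r: "w0 @ r \<in> F"
  shows "res (p @ w0 @ r) \<noteq> {}"
proof -
  obtain x s where x: "p @ w0 = x @ s" "x \<in> star X" "suffix s w0" by (rule res_w0_split[OF p])
  obtain v where v: "w0 = v @ s" using x(3) unfolding suffix_def by blast
  have "s @ r \<in> F" using factorial_set_suffixD[OF fac, of v "s @ r"] r v by simp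
  then have "res (s @ r) \<noteq> {}" by (rule res_nonempty)
  moreover have "p @ w0 @ r = x @ s @ r" using x(1) by (metis append.assoc)
  ultimately show ?thesis by (simp only: res_star[OF x(2)] not_False_eq_True)
qed

lemma \<theta>X_ctxt: "(u, v) \<in> \<theta>X \<Longrightarrow> (a @ u @ b, a @ v @ b) \<in> \<theta>X"
  by (intro list_congruence_append[OF congX] list_congruence_refl[OF congX])

lemma \<theta>X_res: "(u, v) \<in> \<theta>X \<Longrightarrow> res (p @ u) = res (p @ v)"
  using in_\<theta>X by blast

text \<open>Modulo \<open>\<theta>X\<close>, reading \<open>w0\<close> twice is reading it once, and
  nonempty residuals remember the state. So \<open>w0\<close> acts as an idempotent
  permutation.\<close>

lemma run_w0: "q \<in> Q \<Longrightarrow> run \<delta> q w0 = q"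
proof -
  assume q: "q \<in> Q"
  obtain f where f: "f @ w0 \<in> F" "run \<delta> i f = q" by (rule run_before[OF w0_in q])
  have "res (f @ w0) = res (f @ w0 @ w0)" using \<theta>X_res[OF w0_idem] by simp
  from res_run[OF this res_nonempty[OF f(1)]] show ?thesis using f(2) q by simp
qed

definition MX :: "'a list set monoid" where
  "MX = syntactic_monoid (star X)"

lemma MX_mult: "\<theta>X `` {u} \<otimes>\<^bsub>MX\<^esub> \<theta>X `` {v} = \<theta>X `` {u @ v}"
  and MX_carrier: "carrier MX = range (\<lambda>w. \<theta>X `` {w})"
  and MX_monoid: "plain_monoid MX"
  unfolding MX_def syntactic_monoid_def
  by (simp_all add: mult_quotient_monoid[OF congX] carrier_quotient_monoid
      plain_monoid_quotient_monoid[OF congX])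

definition \<epsilon> :: "'a list set" where
  "\<epsilon> = \<theta>X `` {w0}"

lemma \<epsilon>_in: "\<epsilon> \<in> carrier MX" and \<epsilon>_idem: "\<epsilon> \<otimes>\<^bsub>MX\<^esub> \<epsilon> = \<epsilon>"
  using w0_idem by (auto simp: \<epsilon>_def MX_carrier MX_mult congruence_class_eq_iff[OF congX])

lemma in_local_units:
  "\<theta>X `` {u} \<in> local_units MX \<epsilon> \<longleftrightarrow> (w0 @ u, u) \<in> \<theta>X \<and> (u @ w0, u) \<in> \<theta>X \<and>
     (\<exists>k. (w0 @ k, k) \<in> \<theta>X \<and> (k @ w0, k) \<in> \<theta>X \<and> (u @ k, w0) \<in> \<theta>X \<and> (k @ u, w0) \<in> \<theta>X)"
  unfolding local_units_def \<epsilon>_def MX_carrier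
  by (simp add: MX_mult congruence_class_eq_iff[OF congX]) blast

text \<open>The inverse \<open>k\<close> brings \<open>p @ u\<close> back to the residual of
  \<open>p @ w0\<close>, so reading \<open>u\<close> cannot destroy completability.\<close>

lemma unit_res_nonempty:
  assumes u: "\<theta>X `` {u} \<in> local_units MX \<epsilon>" and p: "res (p @ w0) \<noteq> {}"
  shows "res (p @ u @ w0) \<noteq> {}"
proof -
  obtain k where k: "(u @ w0, u) \<in> \<theta>X" "(u @ k, w0) \<in> \<theta>X" using u in_local_units by blast
  have "res ((p @ u) @ k) \<noteq> {}" using \<theta>X_res[OF k(2), of p] p by simp
  then have "res (p @ u) \<noteq> {}" using res_append_empty by blast
  then show ?thesis using \<theta>X_res[OF k(1), of p] by simp
qed

text \<open>Every state is reached by some \<open>f\<close> with \<open>f @ w0\<close> in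
  \<open>F\<close>. The residual after \<open>f @ u @ w0\<close> is then nonempty and determines the
  state, so no state escapes the comparison.\<close>

lemma unit_congruent:
  assumes u: "\<theta>X `` {u} \<in> local_units MX \<epsilon>" and uv: "(u, v) \<in> \<theta>X"
  shows "(u, v) \<in> \<theta>Z"
  unfolding in_\<theta>Z
proof
  fix q assume q: "q \<in> Q"
  obtain f where f: "f @ w0 \<in> F" "run \<delta> i f = q" by (rule run_before[OF w0_in q])
  have ne: "res (f @ u @ w0) \<noteq> {}" by (rule unit_res_nonempty[OF u res_nonempty[OF f(1)]])
  have "(u @ w0, v @ w0) \<in> \<theta>X" using \<theta>X_ctxt[OF uv, of "[]" w0] by simp
  from res_run[OF \<theta>X_res[OF this] ne] show "run \<delta> q u = run \<delta> q v" using f(2) q by simp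
qed

text \<open>If the residual after \<open>p @ w0\<close> is empty, so are both residuals, as units
  absorb \<open>w0\<close> on the left. Otherwise they absorb \<open>w0\<close> on the right, after
  which the state decides.\<close>

lemma unit_congruent_iff:
  assumes u: "\<theta>X `` {u} \<in> local_units MX \<epsilon>" and v: "\<theta>X `` {v} \<in> local_units MX \<epsilon>"
  shows "(u, v) \<in> \<theta>X \<longleftrightarrow> (u, v) \<in> \<theta>Z"
proof
  assume uv: "(u, v) \<in> \<theta>Z"
  show "(u, v) \<in> \<theta>X" unfolding in_\<theta>X
  proof
    fix p
    have 1: "res (p @ u) = res (p @ u @ w0)" "res (p @ v) = res (p @ v @ w0)"
      "res (p @ u) = res ((p @ w0) @ u)" "res (p @ v) = res ((p @ w0) @ v)"
      using u v \<theta>X_res unfolding in_local_units by (metis append.assoc)+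
    show "res (p @ u) = res (p @ v)"
    proof (cases "res (p @ w0) = {}")
      case True
      then show ?thesis using res_append_empty[OF True] 1(3,4) by simp
    next
      case False
      have "run \<delta> i ((p @ u) @ w0) = run \<delta> i ((p @ v) @ w0)"
        using uv by (simp add: in_\<theta>Z)
      then have "res ((p @ u) @ w0) = res ((p @ v) @ w0)"
        using unit_res_nonempty[OF u False] unit_res_nonempty[OF v False] by (intro res_w0_eq) simp_all
      then show ?thesis using 1 by simp
    qed
  qed
qed (rule unit_congruent[OF u])

text \<open>A power of \<open>z = w0 @ r\<close> that acts trivially on \<open>Q\<close> acts on the residuals as \<open>w0\<close> does, by
  \<open>res_w0_eq\<close>; this gives the inverse of \<open>z\<close>.\<close>

lemma return_unit:
  assumes z: "w0 @ r \<in> F" "w0 @ r = r' @ w0"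
  shows "\<theta>X `` {w0 @ r} \<in> local_units MX \<epsilon>"
proof -
  define z where "z = w0 @ r"
  have zr': "z = r' @ w0" unfolding z_def by (rule z(2))
  obtain m where m: "\<And>q. q \<in> Q \<Longrightarrow> run \<delta> q (concat (replicate (Suc m) z)) = q"
    using run_power[of z] by blast
  let ?zm = "concat (replicate m z)"
  note sym = list_congruence_sym[OF congX]
    and trans = list_congruence_trans[OF congX]
  have wz: "(w0 @ z, z) \<in> \<theta>X" using \<theta>X_ctxt[OF w0_idem, of "[]" r] unfolding z_def by simp
  have zw: "(z @ w0, z) \<in> \<theta>X" using \<theta>X_ctxt[OF w0_idem, of r' "[]"] unfolding zr' by simp
  have step: "res ((p @ z) @ w0) \<noteq> {}" if "res (p @ w0) \<noteq> {}" for p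
    using res_w0_append[OF that z(1)] \<theta>X_res[OF zw, of p] unfolding z_def by simp
  have steps: "res ((p @ concat (replicate n z)) @ w0) \<noteq> {}" if p: "res (p @ w0) \<noteq> {}" for p n
  proof (induction n)
    case 0
    then show ?case using p by simp
  next
    case (Suc n)
    from step[OF this] show ?case unfolding concat_replicate_Suc by simp
  qed
  have zm: "(concat (replicate (Suc m) z) @ w0, w0) \<in> \<theta>X" unfolding in_\<theta>X
  proof
    fix p
    show "res (p @ concat (replicate (Suc m) z) @ w0) = res (p @ w0)"
    proof (cases "res (p @ w0) = {}")
      case True
      have "p @ concat (replicate (Suc m) z) @ w0 = (p @ w0) @ (r @ ?zm @ w0)" by (simp add: z_def)
      then show ?thesis using res_append_empty[OF True] True by simp
    next
      case False
      have "run \<delta> i ((p @ concat (replicate (Suc m) z)) @ w0) = run \<delta> i (p @ w0)"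
        using m[of "run \<delta> i p"] by (simp del: replicate_Suc)
      then have "res ((p @ concat (replicate (Suc m) z)) @ w0) = res (p @ w0)"
        by (intro res_w0_eq steps False)
      then show ?thesis by (simp del: replicate_Suc)
    qed
  qed
  \<comment> \<open>Without \<open>w0\<close> on both sides, the remaining power of \<open>z\<close>
    need not lie in the local monoid; for \<open>m = 0\<close> it is even the empty word.\<close>
  define k where "k = w0 @ ?zm @ w0"
  have "(w0 @ k, k) \<in> \<theta>X" using \<theta>X_ctxt[OF w0_idem, of "[]" "?zm @ w0"] by (simp add: k_def)
  moreover have "(k @ w0, k) \<in> \<theta>X" using \<theta>X_ctxt[OF w0_idem, of "w0 @ ?zm" "[]"] by (simp add: k_def)
  moreover have "(z @ k, w0) \<in> \<theta>X"
  proof -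
    have "(z @ k, z @ ?zm @ w0) \<in> \<theta>X" using \<theta>X_ctxt[OF zw, of "[]" "?zm @ w0"] by (simp add: k_def)
    then show ?thesis using trans zm by simp
  qed
  moreover have "(k @ z, w0) \<in> \<theta>X"
  proof -
    have "(k @ z, w0 @ ?zm @ z) \<in> \<theta>X" using \<theta>X_ctxt[OF wz, of "w0 @ ?zm" "[]"] by (simp add: k_def)
    moreover have "(w0 @ ?zm @ z, w0 @ (?zm @ z) @ w0) \<in> \<theta>X"
      using sym[OF \<theta>X_ctxt[OF zw, of "w0 @ ?zm" "[]"]] by simp
    moreover have "(w0 @ (?zm @ z) @ w0, w0 @ w0) \<in> \<theta>X"
      using \<theta>X_ctxt[OF zm[unfolded concat_replicate_Suc], of w0 "[]"] by simp
    ultimately show ?thesis using trans w0_idem by blast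
  qed
  ultimately show ?thesis unfolding in_local_units z_def[symmetric] using wz zw by blast
qed

text \<open>Taking the image of the whole class avoids choosing a representative; on local units it
  is a single class modulo \<open>\<theta>Z\<close>.\<close>

definition to_GZ :: "'a list set \<Rightarrow> 'a list set" where
  "to_GZ C = \<theta>Z `` C"

lemma to_GZ_class:
  assumes u: "\<theta>X `` {u} \<in> local_units MX \<epsilon>"
  shows "to_GZ (\<theta>X `` {u}) = \<theta>Z `` {u}"
proof
  show "\<theta>Z `` {u} \<subseteq> to_GZ (\<theta>X `` {u})"
    using list_congruence_refl[OF congX, of u] unfolding to_GZ_def by blast
  show "to_GZ (\<theta>X `` {u}) \<subseteq> \<theta>Z `` {u}"
  proof
    fix v assume "v \<in> to_GZ (\<theta>X `` {u})"
    then obtain u' where "(u, u') \<in> \<theta>X" "(u', v) \<in> \<theta>Z" unfolding to_GZ_def by blast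
    then have "(u, v) \<in> \<theta>Z" using unit_congruent[OF u] list_congruence_trans[OF congZ] by blast
    then show "v \<in> \<theta>Z `` {u}" by blast
  qed
qed

lemma local_units_cases:
  assumes "C \<in> local_units MX \<epsilon>"
  obtains u where "C = \<theta>X `` {u}" "\<theta>X `` {u} \<in> local_units MX \<epsilon>"
proof -
  have "C \<in> carrier MX" using assms unfolding local_units_def by blast
  then obtain u where "C = \<theta>X `` {u}" unfolding MX_carrier by blast
  with assms show thesis using that by blast
qed

lemma to_GZ_hom: "group_hom (group_at MX \<epsilon>) GZ to_GZ"
proof -
  interpret M: plain_monoid MX by (rule MX_monoid)
  interpret H: group "group_at MX \<epsilon>" by (rule M.group_group_at[OF \<epsilon>_in \<epsilon>_idem])
  have "to_GZ \<in> hom (group_at MX \<epsilon>) GZ"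
  proof (rule homI)
    fix C assume "C \<in> carrier (group_at MX \<epsilon>)"
    then obtain u where "C = \<theta>X `` {u}" "\<theta>X `` {u} \<in> local_units MX \<epsilon>"
      unfolding group_at_simps by (rule local_units_cases)
    then show "to_GZ C \<in> carrier GZ" using to_GZ_class unfolding GZ_carrier by simp
    fix D assume D: "D \<in> carrier (group_at MX \<epsilon>)"
    then obtain v where v: "D = \<theta>X `` {v}" "\<theta>X `` {v} \<in> local_units MX \<epsilon>"
      unfolding group_at_simps by (rule local_units_cases)
    have "C \<otimes>\<^bsub>MX\<^esub> D = \<theta>X `` {u @ v}" unfolding \<open>C = _\<close> v(1) by (rule MX_mult)
    moreover have "C \<otimes>\<^bsub>MX\<^esub> D \<in> local_units MX \<epsilon>"
      using H.m_closed[OF \<open>C \<in> carrier (group_at MX \<epsilon>)\<close> D] by simp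
    ultimately show "to_GZ (C \<otimes>\<^bsub>group_at MX \<epsilon>\<^esub> D) = to_GZ C \<otimes>\<^bsub>GZ\<^esub> to_GZ D"
      using to_GZ_class[OF v(2)] to_GZ_class[OF \<open>\<theta>X `` {u} \<in> _\<close>] to_GZ_class[of "u @ v"]
      unfolding \<open>C = _\<close> v(1) by (simp add: GZ_mult MX_mult)
  qed
  then show ?thesis using H.group_axioms group_GZ
    by (simp add: group_hom_def group_hom_axioms_def)
qed

lemma to_GZ_inj: "inj_on to_GZ (local_units MX \<epsilon>)"
proof (rule inj_onI)
  fix C D assume C: "C \<in> local_units MX \<epsilon>" and D: "D \<in> local_units MX \<epsilon>" and eq: "to_GZ C = to_GZ D"
  obtain u where u: "C = \<theta>X `` {u}" "\<theta>X `` {u} \<in> local_units MX \<epsilon>" using C by (rule local_units_cases)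
  obtain v where v: "D = \<theta>X `` {v}" "\<theta>X `` {v} \<in> local_units MX \<epsilon>" using D by (rule local_units_cases)
  have "(u, v) \<in> \<theta>Z"
    using eq unfolding u(1) v(1) to_GZ_class[OF u(2)] to_GZ_class[OF v(2)] congruence_class_eq_iff[OF congZ] .
  then show "C = D"
    unfolding u(1) v(1) congruence_class_eq_iff[OF congX] unit_congruent_iff[OF u(2) v(2)] .
qed

text \<open>The cosets of the image give a labelling of a Rauzy graph: a long word \<open>u @ w0 @ v\<close> is
  labelled by the coset of \<open>v\<close>. As this labelling is constant, there is only one coset.\<close>

lemma to_GZ_surj: "to_GZ ` local_units MX \<epsilon> = carrier GZ"
proof -
  interpret Z: group GZ by (rule group_GZ)
  interpret h: group_hom "group_at MX \<epsilon>" GZ to_GZ by (rule to_GZ_hom)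
  define K where "K = to_GZ ` local_units MX \<epsilon>"
  have K: "subgroup K GZ" using h.img_is_subgroup unfolding K_def by simp
  then have KG: "K \<subseteq> carrier GZ" by (rule subgroup.subset)
  have cl: "\<theta>Z `` {v} \<in> carrier GZ" for v unfolding GZ_carrier by blast
  let ?coset = "\<lambda>v. K #>\<^bsub>GZ\<^esub> \<theta>Z `` {v}"
  have coset_append: "?coset (u @ v) = ?coset u #>\<^bsub>GZ\<^esub> \<theta>Z `` {v}" for u v
    using Z.coset_mult_assoc[OF KG cl cl, of u v] by (simp add: GZ_mult)
  have coset_wd_le: "?coset v = ?coset v'"
    if x: "x \<in> F" "x = u @ w0 @ v" "x = u' @ w0 @ v'" "length v \<le> length v'" for x u v u' v'
  proof -
    have "suffix v x" "suffix v' x" using x(2,3) by (metis append.assoc suffix_def)+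
    then have "suffix v v'" using x(4) by (rule suffix_length_suffix)
    then obtain r where r: "v' = r @ v" unfolding suffix_def by blast
    \<comment> \<open>Between two occurrences of \<open>w0\<close> in \<open>x\<close> one reads
      \<open>w0 @ r\<close>, which also ends with \<open>w0\<close> and so is a local unit. As
      \<open>w0\<close> acts trivially on \<open>Q\<close>, the value of \<open>r\<close> lies in
      \<open>K\<close>.\<close>
    have eq: "u @ w0 = u' @ (w0 @ r)" using x(2,3) unfolding r by simp
    have "suffix w0 (u @ w0)" "suffix (w0 @ r) (u @ w0)" unfolding suffix_def using eq by blast+
    then have "suffix w0 (w0 @ r)" by (rule suffix_length_suffix) simp
    then obtain r' where r': "w0 @ r = r' @ w0" unfolding suffix_def by blast
    have "w0 @ r \<in> F" using factorial_setD[OF fac, of u' "w0 @ r" v] x(1,3) unfolding r by simp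
    then have unit: "\<theta>X `` {w0 @ r} \<in> local_units MX \<epsilon>" using r' by (rule return_unit)
    have "\<theta>Z `` {r} = \<theta>Z `` {w0 @ r}" unfolding GZ_class_eq by (simp add: run_w0)
    then have "\<theta>Z `` {r} \<in> K" unfolding K_def to_GZ_class[OF unit, symmetric] using unit by simp
    then have "?coset r = K" by (rule Z.coset_join2[OF cl K])
    then show ?thesis unfolding r coset_append by simp
  qed
  have coset_wd: "?coset v = ?coset v'"
    if x: "x \<in> F" "x = u @ w0 @ v" "x = u' @ w0 @ v'" for x u v u' v'
    using coset_wd_le[OF x] coset_wd_le[OF x(1,3,2)] by (cases "length v \<le> length v'") auto
  obtain n where n: "\<And>x. x \<in> F \<Longrightarrow> length x \<ge> n \<Longrightarrow> sublist w0 x"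
    using F(1) w0_in unfolding uniformly_recurrent_def by blast
  define l where "l x = ?coset (SOME v. \<exists>u. x = u @ w0 @ v)" for x
  have l: "l x = ?coset v" if x: "x \<in> F" "x = u @ w0 @ v" for x u v
  proof -
    have "\<exists>u. x = u @ w0 @ (SOME v. \<exists>u. x = u @ w0 @ v)"
      by (rule someI[of "\<lambda>v. \<exists>u. x = u @ w0 @ v" v]) (use x(2) in blast)
    then show ?thesis unfolding l_def using coset_wd[OF x(1) _ x(2)] by blast
  qed
  have "\<exists>s\<in>Pow (carrier GZ). (\<forall>x\<in>F. length x = n \<longrightarrow> l x = s) \<and>
      (\<forall>b. [b] \<in> F \<longrightarrow> s #>\<^bsub>GZ\<^esub> \<theta>Z `` {[b]} = s)"
  proof (rule Rauzy_labelling_constant[OF F(2), where act = "\<lambda>b C. C #>\<^bsub>GZ\<^esub> \<theta>Z `` {[b]}"])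
    show "inj_on (\<lambda>C. C #>\<^bsub>GZ\<^esub> \<theta>Z `` {[b]}) (Pow (carrier GZ))" for b
    proof (rule inj_onI)
      fix C D assume CD: "C \<in> Pow (carrier GZ)" "D \<in> Pow (carrier GZ)"
        "C #>\<^bsub>GZ\<^esub> \<theta>Z `` {[b]} = D #>\<^bsub>GZ\<^esub> \<theta>Z `` {[b]}"
      have inv: "(E #>\<^bsub>GZ\<^esub> \<theta>Z `` {[b]}) #>\<^bsub>GZ\<^esub> inv\<^bsub>GZ\<^esub> (\<theta>Z `` {[b]}) = E" if "E \<subseteq> carrier GZ" for E
        unfolding Z.coset_mult_assoc[OF that cl Z.inv_closed[OF cl]] Z.r_inv[OF cl]
        by (rule Z.coset_mult_one[OF that])
      show "C = D" using inv[OF PowD[OF CD(1)]] unfolding CD(3) inv[OF PowD[OF CD(2)]] by (rule sym)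
    qed
    show "l x \<in> Pow (carrier GZ)" for x
      unfolding l_def using Z.r_coset_subset_G[OF KG cl] by simp
    fix x b assume x: "x @ [b] \<in> F" "length x = n"
    have xF: "x \<in> F" by (rule factorial_set_prefixD[OF fac x(1)])
    then have "sublist w0 x" using n x(2) by simp
    then obtain u v where uv: "x = u @ w0 @ v" unfolding sublist_def by blast
    obtain c y where y: "x @ [b] = [c] @ y" "length y = n"
      using x(2) by (metis append_Cons append_Nil length_Suc_conv length_append_singleton)
    have yF: "y \<in> F" using factorial_set_suffixD[OF fac, of "[c]" y] x(1) y(1) by simp
    then have "sublist w0 y" using n y(2) by simp
    then obtain u' v' where uv': "y = u' @ w0 @ v'" unfolding sublist_def by blast
    \<comment> \<open>The chosen occurrences in \<open>x\<close> and in \<open>y\<close> are both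
      occurrences in \<open>x @ [b]\<close>, a word of \<open>F\<close>.\<close>
    have "?coset v' = ?coset (v @ [b])"
    proof (rule coset_wd[OF x(1)])
      show "x @ [b] = (c # u') @ w0 @ v'" using y(1) uv' by simp
      show "x @ [b] = u @ w0 @ v @ [b]" using uv by simp
    qed
    then have "l y = l x #>\<^bsub>GZ\<^esub> \<theta>Z `` {[b]}"
      unfolding l[OF yF uv'] l[OF xF uv] coset_append .
    then show "l (tl (x @ [b])) = l x #>\<^bsub>GZ\<^esub> \<theta>Z `` {[b]}" using y(1) by simp
  qed
  then obtain s where s: "\<forall>x\<in>F. length x = n \<longrightarrow> l x = s"
    "\<forall>b. [b] \<in> F \<longrightarrow> s #>\<^bsub>GZ\<^esub> \<theta>Z `` {[b]} = s" by (elim bexE conjE) (rule that)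
  obtain x where x: "x \<in> F" "length x = n" using recurrent_long_word[OF rec] by blast
  then have "sublist w0 x" using n by simp
  then obtain u v where uv: "x = u @ w0 @ v" unfolding sublist_def by blast
  have s_eq: "s = ?coset v" using s(1) x l[OF x(1) uv] by simp
  have const: "?coset (v @ t) = s" for t
  proof (induction t rule: rev_induct)
    case Nil
    then show ?case using s_eq by simp
  next
    case (snoc b t)
    have "?coset ((v @ t) @ [b]) = s #>\<^bsub>GZ\<^esub> \<theta>Z `` {[b]}" unfolding coset_append[of "v @ t"] snoc ..
    also have "\<dots> = s" using s(2) F(3) unfolding alphabet_def by auto
    finally show ?case by simp
  qed
  \<comment> \<open>The word \<open>t\<close> represents the inverse of the value of
    \<open>v\<close> times \<open>g\<close>, so \<open>v @ t\<close> represents \<open>g\<close> and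
    every coset is the constant label.\<close>
  have all: "K #>\<^bsub>GZ\<^esub> g = s" if g: "g \<in> carrier GZ" for g
  proof -
    have "inv\<^bsub>GZ\<^esub> (\<theta>Z `` {v}) \<otimes>\<^bsub>GZ\<^esub> g \<in> carrier GZ" using g cl by simp
    then obtain t where t: "inv\<^bsub>GZ\<^esub> (\<theta>Z `` {v}) \<otimes>\<^bsub>GZ\<^esub> g = \<theta>Z `` {t}" unfolding GZ_carrier by blast
    have "\<theta>Z `` {v @ t} = \<theta>Z `` {v} \<otimes>\<^bsub>GZ\<^esub> (inv\<^bsub>GZ\<^esub> (\<theta>Z `` {v}) \<otimes>\<^bsub>GZ\<^esub> g)" unfolding t GZ_mult ..
    also have "\<dots> = g" using g cl by (simp flip: Z.m_assoc)
    finally show ?thesis using const[of t] by simp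
  qed
  have "g \<in> K" if g: "g \<in> carrier GZ" for g
  proof -
    have "K #>\<^bsub>GZ\<^esub> g = K" using all[OF g] all[OF Z.one_closed] Z.coset_mult_one[OF KG] by simp
    then show ?thesis by (rule Z.coset_join1[OF _ g K])
  qed
  then show ?thesis using KG unfolding K_def by blast
qed

lemma group_at_iso_GZ: "group_at MX \<epsilon> \<cong> GZ"
proof -
  interpret h: group_hom "group_at MX \<epsilon>" GZ to_GZ by (rule to_GZ_hom)
  have "to_GZ \<in> iso (group_at MX \<epsilon>) GZ"
    unfolding iso_def using h.homh to_GZ_inj to_GZ_surj by (simp add: bij_betw_def)
  then show ?thesis unfolding is_iso_def by blast
qed

end

lemma (in code_in_connected_set) F_group_of_code_iso: "F_group_of_code F X \<cong> GZ"
proof -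
  obtain e where e: "e \<in> carrier profinite_monoid" "e \<otimes>\<^bsub>profinite_monoid\<^esub> e = e"
    "profinite_closure F = factors_of profinite_monoid {e}"
    "\<forall>n. \<forall>\<theta>\<in>finite_congruences. \<exists>w\<in>F. n \<le> length w \<and> w \<in> e \<theta>"
    by (rule uniformly_recurrent_idempotent[OF F(1)])
  obtain N where N: "\<forall>x\<in>X. length x \<le> N" using bounded_length by blast
  \<comment> \<open>Only the coordinate at \<open>\<theta>X\<close> is needed: \<open>w0\<close>
    represents it, and is taken at least as long as all words of \<open>X\<close>.\<close>
  obtain w0 where w0: "w0 \<in> F" "N \<le> length w0" "w0 \<in> e \<theta>X" using e(4) \<theta>X_finite by blast
  have e_eq: "e \<theta>X = \<theta>X `` {w0}" using profinite_class_iff[OF e(1) \<theta>X_finite] w0(3) by simp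
  have "\<theta>X `` {w0 @ w0} = (e \<otimes>\<^bsub>profinite_monoid\<^esub> e) \<theta>X"
    using profinite_mult_class[OF e(1) e(1) \<theta>X_finite w0(3) w0(3)] by simp
  then have idem: "(w0 @ w0, w0) \<in> \<theta>X"
    unfolding e(2) e_eq congruence_class_eq_iff[OF congX] .
  interpret idempotent_in_connected_set Q i \<delta> Z F X w0
  proof
    show "w0 \<in> F" "(w0 @ w0, w0) \<in> \<theta>X" by (rule w0(1), rule idem)
    show "length x \<le> length w0" if "x \<in> X" for x using N w0(2) that order_trans by blast
  qed
  have "J_of_code F X = J_class_of MX \<epsilon>"
    unfolding J_of_code_eq[OF \<theta>X_finite e(1,2) J_of_eq[OF e(1-3)]] MX_def \<epsilon>_def e_eq ..
  then have eq: "F_group_of_code F X = schutzenberger_group MX (J_class_of MX \<epsilon>)"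
    unfolding F_group_of_code_def by (simp add: MX_def)
  have "finite (carrier MX)" unfolding MX_carrier by (rule finite_congruencesD(2)[OF \<theta>X_finite])
  from schutzenberger_group_iso[OF MX_monoid this \<epsilon>_in \<epsilon>_idem]
  show ?thesis unfolding eq using group_at_iso_GZ by (rule iso_trans)
qed

theorem corollary4p9:
  fixes Z F X :: "'a::finite list set"
  assumes "group_code Z"
    and "uniformly_recurrent F" and "connected_set F" and "alphabet F = UNIV"
    and "X = Z \<inter> F"
  shows "F_degree F X = code_degree Z \<and> F_group_of_code F X \<cong> group_of_code Z"
proof -
  obtain Q :: "nat set" and i \<delta> where aut: "group_automaton Q i \<delta>" "star Z = recognized i \<delta>"
    and code: "code Z" using assms(1) unfolding group_code_def by blast
  interpret code_in_connected_set Q i \<delta> Z F X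
    using aut code assms(2-5) by unfold_locales
  show ?thesis
    using F_degree_eq code_degree_eq iso_trans[OF F_group_of_code_iso group_of_code_iso] by simp
qed

end
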